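(* Suppose that $(X,T,\alpha)$ is a mixing topological Markov shift, that $\mathbb G$ is a countable locally compact, Abelian, Polish topological group, and that $\phi:X\to\mathbb G$ is $\alpha$-measurable and aperiodic. If $\nu$ is a $\sigma$-finite measure on $X$ which is globally supported, locally finite, $\mathfrak T(T,\phi)$-invariant and ergodic, and recurrent, then $\nu\in\mathfrak M_\alpha(X)$, $\nu$ is a Markov measure, and $$\frac{d\nu\circ T}{d\nu}=c\,e^{h\circ\phi}$$ for some homomorphism $h:\mathbb G\to\mathbb R$ and some $c>0$.
   Context: A topological Markov shift with countable state space $S$ and $\{0,1\}$-transition matrix $A$ is $X=\{x\in S^{\mathbb N}: A_{x_i,x_{i+1}}=1\ \forall i\ge1\}$ with the left shift $T$, the partition $\alpha=\{[s]:s\in S\}$, $[s]=\{x\in X:x_1=s\}$ (nonempty), and the topology generated by the cylinders $[s_1,\dots,s_n]$. It is mixing if for all $a,b\in\alpha$, $a\cap T^{-n}b\neq\emptyset$ for all large $n$. A function on $X$ is $\alpha$-measurable if it is constant on each $a\in\alpha$. For $\phi:X\to\mathbb G$ write $\phi_n=\sum_{k=0}^{n-1}\phi\circ T^k$. $\phi$ is aperiodic if the subgroup generated by $\{\phi_n(x)-\phi_n(y): n\ge1,\ T^nx=x,\ T^ny=y\}$ is dense in $\mathbb G$. Let $\mathfrak T(T,\phi)=\{(x,y)\in X^2:\exists n\ge0,\ T^nx=T^ny,\ \phi_n(x)=\phi_n(y)\}$. For a countable Borel equivalence relation $\mathcal R$, an $\mathcal R$-holonomy is a bi-measurable bijection $\kappa:A\to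 B$ of measurable sets with $(x,\kappa x)\in\mathcal R$ for all $x\in A$. A measure $\nu$ is $\mathcal R$-invariant if $\nu(\kappa(C))=\nu(C)$ for all holonomies $\kappa$ and measurable $C$ in the domain of $\kappa$; it is $\mathcal R$-ergodic if every measurable union of $\mathcal R$-classes is null or conull. $\nu$ is globally supported if every nonempty cylinder has positive measure; locally finite if $X$ has a countable cover by open sets of finite measure; recurrent if for each $a\in\alpha$, $\sum_{n\ge0}1_a\circ T^n\in\{0,\infty\}$ $\nu$-a.e. $\mathfrak M_\alpha(X)$ is the set of $\sigma$-finite measures finite on each $a\in\alpha$. $\nu$ is Markov if $\nu([s_1,\dots,s_n])=\nu([s_1])p_{s_1,s_2}\cdots p_{s_{n-1},s_n}$ for some stochastic matrix $(p_{s,t})$. $\frac{d\nu\circ T}{d\nu}$ is the Radon–Nikodym derivative of $B\mapsto\nu(TB)$ with respect to $\nu$, taken on each $a\in\alpha$ (where $T$ is injective). *)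

theory Defs
  imports "HOL-Analysis.Analysis" "HOL-Computational_Algebra.Group_Closure"
begin

section \<open>Topological Markov shifts\<close>

text \<open>The state space is a type of class countable. Sequences are indexed from 0
  rather than from 1, so \<open>x 0\<close> is the first symbol of \<open>x\<close>.\<close>

definition tms :: "('s \<Rightarrow> 's \<Rightarrow> nat) \<Rightarrow> (nat \<Rightarrow> 's) set" where
  "tms A = {x. \<forall>i. A (x i) (x (Suc i)) = 1}"

definition left_shift :: "(nat \<Rightarrow> 's) \<Rightarrow> (nat \<Rightarrow> 's)" where
  "left_shift x = (\<lambda>i. x (Suc i))"

definition cylinder :: "('s \<Rightarrow> 's \<Rightarrow> nat) \<Rightarrow> 's list \<Rightarrow> (nat \<Rightarrow> 's) set" where
  "cylinder A w = {x \<in> tms A. \<forall>i<length w. x i = w ! i}"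

definition state_partition :: "('s \<Rightarrow> 's \<Rightarrow> nat) \<Rightarrow> (nat \<Rightarrow> 's) set set" where
  "state_partition A = range (\<lambda>s. cylinder A [s])"

definition is_tms :: "('s::countable \<Rightarrow> 's \<Rightarrow> nat) \<Rightarrow> bool" where
  "is_tms A \<longleftrightarrow> (\<forall>s t. A s t \<in> {0, 1}) \<and> (\<forall>s. cylinder A [s] \<noteq> {})"

definition mixing :: "('s \<Rightarrow> 's \<Rightarrow> nat) \<Rightarrow> bool" where
  "mixing A \<longleftrightarrow> (\<forall>a\<in>state_partition A. \<forall>b\<in>state_partition A.
     \<forall>\<^sub>F n in sequentially. a \<inter> (left_shift ^^ n) -` b \<noteq> {})"

definition tms_topology :: "('s \<Rightarrow> 's \<Rightarrow> nat) \<Rightarrow> (nat \<Rightarrow> 's) topology" where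
  "tms_topology A = topology_generated_by {cylinder A w |w. w \<noteq> []}"

definition tms_borel :: "('s \<Rightarrow> 's \<Rightarrow> nat) \<Rightarrow> (nat \<Rightarrow> 's) measure" where
  "tms_borel A = sigma (tms A) {U. openin (tms_topology A) U}"

section \<open>Cocycles\<close>

text \<open>Functions on the shift space are total functions on sequences; only their
  values on \<open>tms A\<close> are ever used.\<close>

definition partition_measurable :: "('s \<Rightarrow> 's \<Rightarrow> nat) \<Rightarrow> ((nat \<Rightarrow> 's) \<Rightarrow> 'g) \<Rightarrow> bool" where
  "partition_measurable A \<phi> \<longleftrightarrow> (\<forall>a\<in>state_partition A. \<forall>x\<in>a. \<forall>y\<in>a. \<phi> x = \<phi> y)"

definition birkhoff_sum ::
    "((nat \<Rightarrow> 's) \<Rightarrow> 'g::comm_monoid_add) \<Rightarrow> nat \<Rightarrow> (nat \<Rightarrow> 's) \<Rightarrow> 'g" where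
  "birkhoff_sum \<phi> n x = (\<Sum>k<n. \<phi> ((left_shift ^^ k) x))"

definition aperiodic ::
    "('s \<Rightarrow> 's \<Rightarrow> nat) \<Rightarrow> ((nat \<Rightarrow> 's) \<Rightarrow> 'g::topological_ab_group_add) \<Rightarrow> bool" where
  "aperiodic A \<phi> \<longleftrightarrow>
     closure (group_closure {birkhoff_sum \<phi> n x - birkhoff_sum \<phi> n y |n x y.
       n \<ge> 1 \<and> x \<in> tms A \<and> y \<in> tms A \<and> (left_shift ^^ n) x = x \<and> (left_shift ^^ n) y = y})
     = UNIV"

definition tail_relation ::
    "('s \<Rightarrow> 's \<Rightarrow> nat) \<Rightarrow> ((nat \<Rightarrow> 's) \<Rightarrow> 'g::comm_monoid_add) \<Rightarrow> (nat \<Rightarrow> 's) rel" where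
  "tail_relation A \<phi> = {(x, y). x \<in> tms A \<and> y \<in> tms A \<and>
     (\<exists>n. (left_shift ^^ n) x = (left_shift ^^ n) y \<and> birkhoff_sum \<phi> n x = birkhoff_sum \<phi> n y)}"

section \<open>Invariance and ergodicity with respect to an equivalence relation\<close>

definition holonomy :: "'a measure \<Rightarrow> 'a rel \<Rightarrow> ('a \<Rightarrow> 'a) \<Rightarrow> 'a set \<Rightarrow> 'a set \<Rightarrow> bool" where
  "holonomy M R \<kappa> A B \<longleftrightarrow>
     A \<in> sets M \<and> B \<in> sets M \<and> bij_betw \<kappa> A B \<and>
     \<kappa> \<in> measurable (restrict_space M A) (restrict_space M B) \<and>
     the_inv_into A \<kappa> \<in> measurable (restrict_space M B) (restrict_space M A) \<and>
     (\<forall>x\<in>A. (x, \<kappa> x) \<in> R)"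

definition relation_invariant :: "'a rel \<Rightarrow> 'a measure \<Rightarrow> bool" where
  "relation_invariant R \<nu> \<longleftrightarrow>
     (\<forall>\<kappa> A B. holonomy \<nu> R \<kappa> A B \<longrightarrow>
        (\<forall>C\<in>sets \<nu>. C \<subseteq> A \<longrightarrow> emeasure \<nu> (\<kappa> ` C) = emeasure \<nu> C))"

definition relation_ergodic :: "'a rel \<Rightarrow> 'a measure \<Rightarrow> bool" where
  "relation_ergodic R \<nu> \<longleftrightarrow>
     (\<forall>F. F \<subseteq> space \<nu> // R \<longrightarrow> \<Union>F \<in> sets \<nu> \<longrightarrow>
        \<Union>F \<in> null_sets \<nu> \<or> space \<nu> - \<Union>F \<in> null_sets \<nu>)"

section \<open>Measures on a topological Markov shift\<close>

definition globally_supported :: "('s \<Rightarrow> 's \<Rightarrow> nat) \<Rightarrow> (nat \<Rightarrow> 's) measure \<Rightarrow> bool" where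
  "globally_supported A \<nu> \<longleftrightarrow>
     (\<forall>w. w \<noteq> [] \<longrightarrow> cylinder A w \<noteq> {} \<longrightarrow> emeasure \<nu> (cylinder A w) > 0)"

definition locally_finite :: "('s \<Rightarrow> 's \<Rightarrow> nat) \<Rightarrow> (nat \<Rightarrow> 's) measure \<Rightarrow> bool" where
  "locally_finite A \<nu> \<longleftrightarrow>
     (\<exists>\<U>. countable \<U> \<and> \<Union>\<U> = tms A \<and>
        (\<forall>U\<in>\<U>. openin (tms_topology A) U \<and> emeasure \<nu> U < \<infinity>))"

definition recurrent :: "('s \<Rightarrow> 's \<Rightarrow> nat) \<Rightarrow> (nat \<Rightarrow> 's) measure \<Rightarrow> bool" where
  "recurrent A \<nu> \<longleftrightarrow>
     (\<forall>a\<in>state_partition A. AE x in \<nu>.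
        (\<Sum>n. indicator a ((left_shift ^^ n) x) :: ennreal) \<in> {0, \<infinity>})"

definition partition_finite_measures :: "('s \<Rightarrow> 's \<Rightarrow> nat) \<Rightarrow> (nat \<Rightarrow> 's) measure set" where
  "partition_finite_measures A =
     {\<nu>. sets \<nu> = sets (tms_borel A) \<and> sigma_finite_measure \<nu> \<and>
         (\<forall>a\<in>state_partition A. emeasure \<nu> a < \<infinity>)}"

definition stochastic_matrix :: "('s \<Rightarrow> 's \<Rightarrow> real) \<Rightarrow> bool" where
  "stochastic_matrix p \<longleftrightarrow> (\<forall>s t. 0 \<le> p s t) \<and> (\<forall>s. (p s has_sum 1) UNIV)"

definition markov_measure :: "('s \<Rightarrow> 's \<Rightarrow> nat) \<Rightarrow> (nat \<Rightarrow> 's) measure \<Rightarrow> bool" where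
  "markov_measure A \<nu> \<longleftrightarrow>
     (\<exists>p. stochastic_matrix p \<and>
        (\<forall>w. w \<noteq> [] \<longrightarrow> emeasure \<nu> (cylinder A w) =
           emeasure \<nu> (cylinder A [hd w]) * ennreal (\<Prod>i<length w - 1. p (w ! i) (w ! Suc i))))"

text \<open>\<open>is_shift_derivative A \<nu> f\<close>: \<open>f\<close> is a version of the Radon--Nikodym derivative
  \<open>d(\<nu> \<circ> T)/d\<nu>\<close>. The set function \<open>B \<mapsto> \<nu>(T B)\<close> is a measure only on
  each partition set, where the shift \<open>T\<close> is injective, so the defining identity
  is required for Borel sets contained in a single partition set.\<close>

definition is_shift_derivative ::
    "('s \<Rightarrow> 's \<Rightarrow> nat) \<Rightarrow> (nat \<Rightarrow> 's) measure \<Rightarrow> ((nat \<Rightarrow> 's) \<Rightarrow> ennreal) \<Rightarrow> bool" where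
  "is_shift_derivative A \<nu> f \<longleftrightarrow>
     f \<in> borel_measurable \<nu> \<and>
     (\<forall>a\<in>state_partition A. \<forall>B\<in>sets \<nu>. B \<subseteq> a \<longrightarrow>
        left_shift ` B \<in> sets \<nu> \<and>
        emeasure \<nu> (left_shift ` B) = (\<integral>\<^sup>+x\<in>B. f x \<partial>\<nu>))"

end

theory Submission
  imports Defs "HOL-Library.Omega_Words_Fun"
begin

text \<open>Write \<open>w B\<close> for the set of admissible sequences \<open>w \<frown> z\<close> with \<open>z \<in> B\<close>, and call the pair
consisting of the length and the \<open>\<phi>\<close>-sum of a word its data. Since \<open>\<phi>\<close> only depends on the first
letter, exchanging an initial path for another one with the same end point and the same data is a
holonomy, so invariance says that \<open>\<nu> (v B) = \<nu> (w B)\<close> for such paths \<open>v\<close> and \<open>w\<close>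
(\<open>emeasure_prepend_same_data\<close>). Recurrence and ergodicity imply that almost every sequence visits
a given state \<open>a\<close> infinitely often, and that for any two sets \<open>E\<close>, \<open>F\<close> of positive measure
there are \<open>v B \<subseteq> E\<close> and \<open>w B \<subseteq> F\<close> of the same positive measure, where \<open>v\<close> and \<open>w\<close> have the same data and
\<open>B \<subseteq> [a]\<close> (\<open>transit\<close>).

The heart of the proof is that prepending a loop \<open>e\<close> at \<open>a\<close> multiplies the measure on \<open>[a]\<close> by a
constant. Let \<open>u\<close> be a loop at \<open>a\<close> with \<open>\<nu> (u [a]) < \<infinity>\<close>; local finiteness provides one. Up to a null
set, \<open>[a]\<close> is the disjoint union of the sets \<open>r [a]\<close>, where \<open>r\<close> runs over the loops which end at the
first visit to \<open>a\<close> at or after time \<open>length e\<close>. As the data of \<open>u r q\<close> and \<open>u q r\<close> agree for every loop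
\<open>q\<close> at \<open>a\<close>, summing over \<open>r\<close> and over suitable \<open>q\<close> shows that the map which removes \<open>r\<close> preserves the finite measure
\<open>B \<mapsto> \<nu> (u B)\<close> on \<open>[a]\<close> (\<open>loop_measure_return_invariant\<close>). One of these loops \<open>r\<close> is \<open>e\<close>, so
\<open>\<nu> (u e B) \<le> \<nu> (u B)\<close>. The Radon--Nikodym density of \<open>B \<mapsto> \<nu> (u e B)\<close> with respect to \<open>B \<mapsto> \<nu> (u B)\<close> is
invariant under the tail relation, hence constant by ergodicity (\<open>loop_scaling_relative\<close>).

Almost all of \<open>[a]\<close> is covered by sets \<open>w [a]\<close> where \<open>w\<close> has the data of a loop \<open>u v\<close>. On each of
them \<open>\<nu> (u B)\<close> is a fixed multiple of \<open>\<nu> B\<close>, whence \<open>\<nu> [a] < \<infinity>\<close> (\<open>cyl_finite\<close>), and so the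
empty loop is admitted for \<open>u\<close>. The resulting factors \<open>scal a e\<close> are multiplicative in \<open>e\<close> and
only depend on the data of \<open>e\<close>. By mixing and aperiodicity the data of loops at \<open>a\<close> generate the
group \<open>\<int> \<times> G\<close>; here the closure in the definition of aperiodicity plays no role, because a
countable completely metrizable group is discrete. Therefore \<open>scal a e\<close> is
\<open>exp (length e * \<kappa> - h (\<phi>-sum of e))\<close> for a real \<open>\<kappa>\<close> and a homomorphism \<open>h\<close>
(\<open>scal_homomorphism\<close>). Transit between different states shows that \<open>\<kappa>\<close> and \<open>h\<close> do not depend
on \<open>a\<close> and that the same formula holds for prepending a single letter (\<open>letter_scaling\<close>). This is
the formula for the derivative with \<open>c = exp (- \<kappa>)\<close>, and the Markov property follows from it.\<close>

section \<open>Words and paths\<close>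

text \<open>\<open>word_path A a w b\<close>: the word \<open>w\<close> followed by the letter \<open>b\<close> is an admissible word
  with first letter \<open>a\<close>. The end point \<open>b\<close> is not a letter of \<open>w\<close>, so that paths are composed by
  concatenating words, and the empty word is the trivial path at every state.\<close>

fun word_path :: "('s \<Rightarrow> 's \<Rightarrow> nat) \<Rightarrow> 's \<Rightarrow> 's list \<Rightarrow> 's \<Rightarrow> bool" where
  "word_path A a [] b \<longleftrightarrow> a = b"
| "word_path A a (s # w) b \<longleftrightarrow> s = a \<and> (\<exists>t. A a t = 1 \<and> word_path A t w b)"

lemma word_path_append:
  "word_path A a (v @ w) b \<longleftrightarrow> (\<exists>t. word_path A a v t \<and> word_path A t w b)"
  by (induction v arbitrary: a) auto

lemma word_path_appendI:
  "word_path A a v t \<Longrightarrow> word_path A t w b \<Longrightarrow> word_path A a (v @ w) b"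
  by (auto simp: word_path_append)

lemma word_path_start: "word_path A a w (z 0) \<Longrightarrow> (w \<frown> z) 0 = a"
  by (cases w) auto

lemma tms_build: "s ## x \<in> tms A \<longleftrightarrow> A s (x 0) = 1 \<and> x \<in> tms A"
proof
  assume "s ## x \<in> tms A"
  then have *: "A ((s ## x) i) ((s ## x) (Suc i)) = 1" for i
    by (simp add: tms_def)
  show "A s (x 0) = 1 \<and> x \<in> tms A"
    using *[of 0] *[of "Suc _"] by (auto simp: tms_def)
next
  assume *: "A s (x 0) = 1 \<and> x \<in> tms A"
  have "A ((s ## x) i) ((s ## x) (Suc i)) = 1" for i
    using * by (cases i) (auto simp: tms_def)
  then show "s ## x \<in> tms A" by (simp add: tms_def)
qed

lemma tms_conc:
  assumes "z \<in> tms A"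
  shows "w \<frown> z \<in> tms A \<longleftrightarrow> word_path A ((w \<frown> z) 0) w (z 0)"
proof (induction w)
  case Nil
  then show ?case using assms by simp
next
  case (Cons s w)
  show ?case
    by (auto simp: tms_build Cons dest: word_path_start)
qed

lemma tms_suffix: "x \<in> tms A \<Longrightarrow> suffix n x \<in> tms A"
  by (simp add: tms_def)

lemma conc_in_tmsD: "w \<frown> z \<in> tms A \<Longrightarrow> z \<in> tms A"
  using tms_suffix[of _ A "length w"] by fastforce

lemma funpow_left_shift: "(left_shift ^^ n) x = suffix n x"
  by (induction n) (auto simp: left_shift_def suffix_def)

lemma conc_prefix_suffix: "prefix n x \<frown> suffix n x = x"
  by (rule prefix_suffix[symmetric])

lemma prefix_add: "prefix (n + k) u = prefix n u @ prefix k (suffix n u)"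
  using subsequence_append[where i=n and j=k and w=u] subsequence_shift[where i=n and w=u and j=0 and k=k] by simp

lemma word_path_in_tms:
  "z \<in> tms A \<Longrightarrow> word_path A a w (z 0) \<Longrightarrow> w \<frown> z \<in> tms A"
  using tms_conc[of z A w] word_path_start[of A a w z] by simp

lemma prefix_word_path: "x \<in> tms A \<Longrightarrow> word_path A (x 0) (prefix n x) (x n)"
  using tms_conc[of "suffix n x" A "prefix n x"] tms_suffix[of x A n]
  by (simp add: conc_prefix_suffix)

section \<open>The Borel structure\<close>

text \<open>The set \<open>w B\<close> of all sequences in the shift space that consist of the word \<open>w\<close> followed by an
  element of \<open>B\<close>. Sequences \<open>w \<frown> z\<close> that are not admissible are discarded.\<close>

definition prepend :: "('s \<Rightarrow> 's \<Rightarrow> nat) \<Rightarrow> 's list \<Rightarrow> (nat \<Rightarrow> 's) set \<Rightarrow> (nat \<Rightarrow> 's) set" where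
  "prepend A w B = {w \<frown> z |z. z \<in> B \<and> w \<frown> z \<in> tms A}"

lemma mem_cylinder_iff: "x \<in> cylinder A w \<longleftrightarrow> x \<in> tms A \<and> prefix (length w) x = w"
proof -
  have "prefix (length w) x = w \<longleftrightarrow> (\<forall>i<length w. x i = w ! i)"
    unfolding subsequence_def by (subst list_eq_iff_nth_eq) simp
  then show ?thesis unfolding cylinder_def by blast
qed

lemma mem_cylinder_state: "x \<in> cylinder A [a] \<longleftrightarrow> x \<in> tms A \<and> x 0 = a"
  by (auto simp: cylinder_def)

lemma cylinder_prefix: "cylinder A (prefix n x) = {y \<in> tms A. \<forall>i<n. y i = x i}"
  by (auto simp: cylinder_def)

lemma prepend_subset_tms: "prepend A w B \<subseteq> tms A"
  by (auto simp: prepend_def)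

lemma prepend_eq:
  "prepend A w B = {x \<in> tms A. prefix (length w) x = w \<and> suffix (length w) x \<in> B}"
proof safe
  fix x assume x: "x \<in> tms A" "prefix (length w) x = w" "suffix (length w) x \<in> B"
  have eq: "w \<frown> suffix (length w) x = x"
    using conc_prefix_suffix[where n="length w" and x=x] unfolding x(2) .
  show "x \<in> prepend A w B"
    unfolding prepend_def mem_Collect_eq
    by (rule exI[of _ "suffix (length w) x"]) (use x eq in simp)
qed (auto simp: prepend_def)

lemma prepend_mono: "B \<subseteq> C \<Longrightarrow> prepend A w B \<subseteq> prepend A w C"
  by (auto simp: prepend_def)

lemma prepend_Nil: "B \<subseteq> tms A \<Longrightarrow> prepend A [] B = B"
  by (auto simp: prepend_def)

lemma prepend_append: "prepend A (v @ w) B = prepend A v (prepend A w B)"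
proof -
  have *: "w \<frown> z \<in> tms A" if "(v @ w) \<frown> z \<in> tms A" for z
    using conc_in_tmsD[of v "w \<frown> z" A] that by simp
  show ?thesis
  proof safe
    fix x assume "x \<in> prepend A (v @ w) B"
    then obtain z where z: "z \<in> B" "x = (v @ w) \<frown> z" "(v @ w) \<frown> z \<in> tms A"
      by (auto simp: prepend_def)
    then show "x \<in> prepend A v (prepend A w B)"
      using * unfolding prepend_def by (intro CollectI exI[of _ "w \<frown> z"]) auto
  qed (auto simp: prepend_def)
qed

lemma prepend_path_subset:
  assumes "B \<subseteq> cylinder A [b]" "word_path A a w b"
  shows "prepend A w B = (\<frown>) w ` B" "prepend A w B \<subseteq> cylinder A [a]"
proof -
  have *: "w \<frown> z \<in> tms A \<and> (w \<frown> z) 0 = a" if "z \<in> B" for z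
    using that assms word_path_in_tms[of z A a w] word_path_start[of A a w z]
    by (auto simp: mem_cylinder_state)
  show "prepend A w B = (\<frown>) w ` B" using * by (auto simp: prepend_def)
  show "prepend A w B \<subseteq> cylinder A [a]" using * by (auto simp: prepend_def mem_cylinder_state)
qed

lemma openin_tms_topologyD:
  assumes "openin (tms_topology A) U" "x \<in> U"
  shows "\<exists>n. cylinder A (prefix (Suc n) x) \<subseteq> U \<and> x \<in> tms A"
proof -
  have "generate_topology_on {cylinder A w |w. w \<noteq> []} U"
    using assms(1) by (simp add: tms_topology_def openin_topology_generated_by_iff)
  then show ?thesis using assms(2)
  proof (induction)
    case (Int U V)
    then obtain m n where mn: "cylinder A (prefix (Suc m) x) \<subseteq> U" "cylinder A (prefix (Suc n) x) \<subseteq> V"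
      "x \<in> tms A" by blast
    have *: "cylinder A (prefix (Suc (max m n)) x) \<subseteq> cylinder A (prefix (Suc k) x)" if "k \<le> max m n" for k
      unfolding cylinder_prefix using that by auto
    have "cylinder A (prefix (Suc (max m n)) x) \<subseteq> U \<inter> V"
      using mn *[of m] *[of n] by auto
    then show ?case using mn(3) by blast
  next
    case (Basis U)
    then obtain w where w: "U = cylinder A w" "w \<noteq> []" by blast
    then have len: "Suc (length w - 1) = length w" by (cases w) simp_all
    have "x \<in> tms A" "prefix (length w) x = w"
      using Basis(2) by (simp_all only: w mem_cylinder_iff)
    then show ?case
      by (intro exI[of _ "length w - 1"] conjI) (simp_all only: w len order_refl)
  qed blast+
qed

text \<open>There are only countably many cylinders and every open set is a union of cylinders, so the
  cylinders generate the Borel sets.\<close>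

lemma sets_tms_borel:
  fixes A :: "'s::countable \<Rightarrow> 's \<Rightarrow> nat"
  shows "sets (tms_borel A) = sigma_sets (tms A) {cylinder A w |w. w \<noteq> []}"
    and space_tms_borel: "space (tms_borel A) = tms A"
proof -
  have sub: "U \<subseteq> tms A" if "openin (tms_topology A) U" for U
    using openin_tms_topologyD[OF that] by auto
  then have *: "{U. openin (tms_topology A) U} \<subseteq> Pow (tms A)" by auto
  then show "space (tms_borel A) = tms A"
    by (simp add: tms_borel_def space_measure_of)
  have "sets (tms_borel A) = sigma_sets (tms A) {U. openin (tms_topology A) U}"
    using * by (simp add: tms_borel_def sets_measure_of)
  also have "\<dots> = sigma_sets (tms A) {cylinder A w |w. w \<noteq> []}"
  proof (intro sigma_sets_eqI)
    fix U assume "U \<in> {U. openin (tms_topology A) U}"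
    then have U: "openin (tms_topology A) U" by simp
    have "U = (\<Union>w\<in>{w. w \<noteq> [] \<and> cylinder A w \<subseteq> U}. cylinder A w)"
    proof
      show "U \<subseteq> (\<Union>w\<in>{w. w \<noteq> [] \<and> cylinder A w \<subseteq> U}. cylinder A w)"
      proof
        fix x assume "x \<in> U"
        then obtain n where n: "cylinder A (prefix (Suc n) x) \<subseteq> U" "x \<in> tms A"
          using openin_tms_topologyD[OF U] by blast
        have "x \<in> cylinder A (prefix (Suc n) x)" "prefix (Suc n) x \<noteq> []"
          using n(2) by (simp_all add: mem_cylinder_iff)
        then show "x \<in> (\<Union>w\<in>{w. w \<noteq> [] \<and> cylinder A w \<subseteq> U}. cylinder A w)" using n(1) by blast
      qed
    qed auto
    moreover have "(\<Union>w\<in>{w. w \<noteq> [] \<and> cylinder A w \<subseteq> U}. cylinder A w)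
      \<in> sigma_sets (tms A) {cylinder A w |w. w \<noteq> []}"
      by (intro sigma_sets_UNION) auto
    ultimately show "U \<in> sigma_sets (tms A) {cylinder A w |w. w \<noteq> []}" by metis
  next
    fix U assume "U \<in> {cylinder A w |w. w \<noteq> []}"
    then show "U \<in> sigma_sets (tms A) {U. openin (tms_topology A) U}"
      by (intro sigma_sets.Basic)
        (auto simp: tms_topology_def openin_topology_generated_by_iff intro: generate_topology_on.Basis)
  qed
  finally show "sets (tms_borel A) = sigma_sets (tms A) {cylinder A w |w. w \<noteq> []}" .
qed

text \<open>A measure on the Borel sets of the shift space; nothing is assumed about the transition
  matrix.\<close>

locale shift_measure =
  fixes A :: "'s::countable \<Rightarrow> 's \<Rightarrow> nat" and M :: "(nat \<Rightarrow> 's) measure"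
  assumes sets_M: "sets M = sets (tms_borel A)"
begin

abbreviation cyl :: "'s \<Rightarrow> (nat \<Rightarrow> 's) set" where
  "cyl a \<equiv> cylinder A [a]"

lemma space_M [simp]: "space M = tms A"
  using sets_eq_imp_space_eq[OF sets_M] by (simp add: space_tms_borel)

lemma tms_in_sets [measurable, simp]: "tms A \<in> sets M"
  using sets.top[of M] by simp

lemma sets_M_generated: "sets M = sigma_sets (tms A) {cylinder A w |w. w \<noteq> []}"
  by (simp add: sets_M sets_tms_borel)

lemma cylinder_in_sets [measurable, simp]: "cylinder A w \<in> sets M"
proof (cases "w = []")
  case True
  then have "cylinder A w = space M" by (auto simp: cylinder_def)
  then show ?thesis by simp
qed (auto simp: sets_M_generated)

lemma sets_subset_tms: "B \<in> sets M \<Longrightarrow> B \<subseteq> tms A"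
  using sets.sets_into_space[of B M] by simp

lemma measurable_letter [measurable]: "(\<lambda>x. x i) \<in> measurable M (count_space UNIV)"
proof (rule measurable_count_space_eq2_countable[THEN iffD2], intro conjI ballI)
  fix a
  have "(\<lambda>x. x i) -` {a} \<inter> space M = (\<Union>w\<in>{w. length w = Suc i \<and> w ! i = a}. cylinder A w)"
    by (auto simp: mem_cylinder_iff intro!: exI[of _ "prefix (Suc i) _"])
      (auto simp: subsequence_def nth_append)
  then show "(\<lambda>x. x i) -` {a} \<inter> space M \<in> sets M"
    by (simp add: sets.countable_UN'' )
qed auto

lemma measurable_prefix [measurable]: "prefix n \<in> measurable M (count_space UNIV)"
proof (rule measurable_count_space_eq2_countable[THEN iffD2], intro conjI ballI)
  fix w :: "'s list"
  have "prefix n -` {w} \<inter> space M = (if length w = n then cylinder A w else {})"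
    by (auto simp: mem_cylinder_iff)
  then show "prefix n -` {w} \<inter> space M \<in> sets M" by simp
qed auto

lemma measurable_into_M:
  assumes N: "g \<in> space N \<rightarrow> tms A" and *: "\<And>i. (\<lambda>x. g x i) \<in> measurable N (count_space UNIV)"
  shows "g \<in> measurable N M"
proof (rule measurable_sigma_sets[OF sets_M_generated])
  show "{cylinder A w |w. w \<noteq> []} \<subseteq> Pow (tms A)" by (auto simp: cylinder_def)
  fix C assume "C \<in> {cylinder A w |w. w \<noteq> []}"
  then obtain w where w: "C = cylinder A w" by auto
  have "g -` C \<inter> space N = {x \<in> space N. \<forall>i<length w. g x i = w ! i}"
    using N by (auto simp: w cylinder_def)
  also have "\<dots> \<in> sets N" using * by measurable
  finally show "g -` C \<inter> space N \<in> sets N" .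
qed (rule N)

lemma measurable_suffix [measurable]: "suffix n \<in> measurable M M"
  by (rule measurable_into_M) (auto simp: tms_suffix)

lemma vimage_conc_in_sets [measurable]:
  assumes "E \<in> sets M"
  shows "{z \<in> tms A. w \<frown> z \<in> E} \<in> sets M"
proof -
  define G where "G = {z \<in> tms A. w \<frown> z \<in> tms A}"
  have "G = {z \<in> space M. word_path A ((w @ [z 0]) ! 0) w (z 0)}"
    using tms_conc[of _ A w] by (cases w) (auto simp: G_def)
  also have "\<dots> \<in> sets M" by measurable
  finally have G [measurable]: "G \<in> sets M" .
  define g where "g = (\<lambda>z. if z \<in> G then w \<frown> z else z)"
  have "(\<lambda>z. g z i) \<in> measurable M (count_space UNIV)" for i
  proof (cases "i < length w")
    case True
    then have "(\<lambda>z. g z i) = (\<lambda>z. if z \<in> G then w ! i else z i)" by (auto simp: g_def)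
    then show ?thesis by simp
  next
    case False
    then have "(\<lambda>z. g z i) = (\<lambda>z. if z \<in> G then z (i - length w) else z i)" by (auto simp: g_def)
    then show ?thesis by simp
  qed
  then have "g \<in> measurable M M"
    by (intro measurable_into_M) (auto simp: g_def G_def)
  then have "g -` E \<inter> space M \<inter> G \<in> sets M"
    using measurable_sets[of g M M E] assms G by blast
  moreover have "g -` E \<inter> space M \<inter> G = {z \<in> tms A. w \<frown> z \<in> E}"
    using sets_subset_tms[OF assms] by (auto simp: g_def G_def)
  ultimately show ?thesis by simp
qed

lemma prepend_in_sets [measurable]:
  assumes [measurable]: "B \<in> sets M" shows "prepend A w B \<in> sets M"
proof -
  have "prepend A w B = {x \<in> space M. prefix (length w) x = w \<and> suffix (length w) x \<in> B}"
    by (simp add: prepend_eq)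
  also have "\<dots> \<in> sets M" by measurable
  finally show ?thesis .
qed

text \<open>The measure \<open>B \<mapsto> M (w B)\<close>, which is concentrated on the set of sequences that may follow \<open>w\<close>.\<close>

definition word_measure :: "'s list \<Rightarrow> (nat \<Rightarrow> 's) measure" where
  "word_measure w = distr (restrict_space M (cylinder A w)) M (suffix (length w))"

lemma sets_word_measure [measurable_cong, simp]: "sets (word_measure w) = sets M"
  by (simp add: word_measure_def)

lemma space_word_measure [simp]: "space (word_measure w) = tms A"
  by (simp add: word_measure_def)

lemma emeasure_word_measure:
  assumes [measurable]: "B \<in> sets M"
  shows "emeasure (word_measure w) B = emeasure M (prepend A w B)"
proof -
  have *: "suffix (length w) \<in> measurable (restrict_space M (cylinder A w)) M"
    by (intro measurable_restrict_space1) measurable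
  have "emeasure (word_measure w) B =
    emeasure M (suffix (length w) -` B \<inter> (cylinder A w \<inter> tms A))"
    unfolding word_measure_def
    by (subst emeasure_distr[OF *], simp, subst emeasure_restrict_space)
      (auto simp: space_restrict_space Int_ac intro!: arg_cong[where f="emeasure M"])
  also have "suffix (length w) -` B \<inter> (cylinder A w \<inter> tms A) = prepend A w B"
    by (auto simp: prepend_eq mem_cylinder_iff)
  finally show ?thesis .
qed

end

section \<open>The tail relation\<close>

text \<open>Measures that are invariant and ergodic for the tail relation of a function \<open>\<phi>\<close> which depends on
  the first letter only, through \<open>f\<close>. Of the mixing property only irreducibility is used here; the
  target \<open>'g\<close> of \<open>\<phi>\<close> carries no topology.\<close>

locale tail_ergodic_measure = shift_measure A M
  for A :: "'s::countable \<Rightarrow> 's \<Rightarrow> nat" and M :: "(nat \<Rightarrow> 's) measure" +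
  fixes \<phi> :: "(nat \<Rightarrow> 's) \<Rightarrow> 'g::ab_group_add" and f :: "'s \<Rightarrow> 'g"
  assumes cyl_nonempty: "cyl a \<noteq> {}"
    and connected: "\<exists>w. word_path A a w b"
    and \<phi>_eq: "x \<in> tms A \<Longrightarrow> \<phi> x = f (x 0)"
    and supported: "globally_supported A M"
    and loc_finite: "locally_finite A M"
    and invariant: "relation_invariant (tail_relation A \<phi>) M"
    and ergodic: "relation_ergodic (tail_relation A \<phi>) M"
    and recurrent: "recurrent A M"
begin

abbreviation fsum :: "'s list \<Rightarrow> 'g" where
  "fsum w \<equiv> sum_list (map f w)"

text \<open>Two words have the same data if they have the same length and the same \<open>\<phi>\<close>-sum. As the group is
  abelian, the data do not change when the factors of a word are permuted.\<close>

definition same_data :: "'s list \<Rightarrow> 's list \<Rightarrow> bool" where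
  "same_data v w \<longleftrightarrow> length v = length w \<and> fsum v = fsum w"

lemma same_data_sym: "same_data v w \<Longrightarrow> same_data w v"
  by (simp add: same_data_def)

lemma same_data_append:
  "same_data v w \<Longrightarrow> same_data v' w' \<Longrightarrow> same_data (v @ v') (w @ w')"
  by (simp add: same_data_def)

lemma same_data_refl [simp]: "same_data v v"
  by (simp add: same_data_def)

lemma birkhoff_sum_eq:
  assumes "x \<in> tms A" shows "birkhoff_sum \<phi> n x = fsum (prefix n x)"
proof -
  have "\<phi> ((left_shift ^^ k) x) = f (x k)" for k
    using \<phi>_eq[of "suffix k x"] tms_suffix[OF assms] by (simp add: funpow_left_shift)
  then have "birkhoff_sum \<phi> n x = (\<Sum>k<n. f (x k))"
    by (simp add: birkhoff_sum_def)
  then show ?thesis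
    by (induction n) (simp_all add: birkhoff_sum_def lessThan_Suc interv_sum_list_conv_sum_set_nat
        subsequence_def sum_list_distinct_conv_sum_set atLeast0LessThan ac_simps)
qed

lemma tail_relation_iff:
  "(x, y) \<in> tail_relation A \<phi> \<longleftrightarrow> x \<in> tms A \<and> y \<in> tms A \<and>
     (\<exists>n. \<forall>m\<ge>n. suffix m x = suffix m y \<and> same_data (prefix m x) (prefix m y))"
    (is "_ \<longleftrightarrow> ?R")
proof
  assume "(x, y) \<in> tail_relation A \<phi>"
  then obtain n where *: "x \<in> tms A" "y \<in> tms A"
      "suffix n x = suffix n y" "fsum (prefix n x) = fsum (prefix n y)"
    by (auto simp: tail_relation_def birkhoff_sum_eq funpow_left_shift)
  have "suffix m x = suffix m y \<and> same_data (prefix m x) (prefix m y)" if "m \<ge> n" for m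
  proof -
    obtain k where m: "m = n + k" using \<open>m \<ge> n\<close> le_Suc_ex by blast
    have "suffix m u = suffix k (suffix n u)" for u :: "nat \<Rightarrow> 's"
      unfolding m by (rule suffix_suffix[symmetric])
    moreover have "prefix m u = prefix n u @ prefix k (suffix n u)" for u :: "nat \<Rightarrow> 's"
      unfolding m by (rule prefix_add)
    ultimately show ?thesis
      using * by (simp only: same_data_def map_append sum_list_append length_append subsequence_length)
  qed
  with * show ?R by blast
next
  assume ?R
  then obtain n where *: "x \<in> tms A" "y \<in> tms A"
      "suffix n x = suffix n y" "fsum (prefix n x) = fsum (prefix n y)"
    unfolding same_data_def by blast
  then show "(x, y) \<in> tail_relation A \<phi>"
    unfolding tail_relation_def by (auto simp only: birkhoff_sum_eq funpow_left_shift)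
qed

lemma tail_relation_conc:
  assumes "same_data v w" "v \<frown> z \<in> tms A" "w \<frown> z \<in> tms A"
  shows "(v \<frown> z, w \<frown> z) \<in> tail_relation A \<phi>"
  using assms by (auto simp: tail_relation_def birkhoff_sum_eq funpow_left_shift same_data_def
      intro!: exI[of _ "length w"])

lemma tail_relation_refl: "x \<in> tms A \<Longrightarrow> (x, x) \<in> tail_relation A \<phi>"
  by (simp add: tail_relation_iff)

lemma tail_relation_trans:
  assumes "(x, y) \<in> tail_relation A \<phi>" "(y, z) \<in> tail_relation A \<phi>"
  shows "(x, z) \<in> tail_relation A \<phi>"
proof -
  obtain m n where "\<forall>k\<ge>m. suffix k x = suffix k y \<and> same_data (prefix k x) (prefix k y)"
    "\<forall>k\<ge>n. suffix k y = suffix k z \<and> same_data (prefix k y) (prefix k z)"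
    using assms unfolding tail_relation_iff by blast
  then have "\<forall>k\<ge>max m n. suffix k x = suffix k z \<and> same_data (prefix k x) (prefix k z)"
    by (simp add: same_data_def)
  then show ?thesis using assms unfolding tail_relation_iff by blast
qed

text \<open>Ergodicity, stated for sets closed under the relation instead of unions of classes.\<close>

lemma saturated_null_or_conull:
  assumes Z: "Z \<in> sets M" and sat: "\<And>x y. x \<in> Z \<Longrightarrow> (x, y) \<in> tail_relation A \<phi> \<Longrightarrow> y \<in> Z"
  shows "Z \<in> null_sets M \<or> tms A - Z \<in> null_sets M"
proof -
  define F where "F = (\<lambda>x. tail_relation A \<phi> `` {x}) ` Z"
  have "x \<in> \<Union>F" if "x \<in> Z" for x
    using that tail_relation_refl[of x] sets_subset_tms[OF Z] unfolding F_def by blast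
  moreover have "x \<in> Z" if "x \<in> \<Union>F" for x
    using that sat unfolding F_def by blast
  ultimately have "\<Union>F = Z" by blast
  moreover have "F \<subseteq> space M // tail_relation A \<phi>"
    using sets_subset_tms[OF Z] by (auto simp: F_def quotient_def)
  ultimately show ?thesis
    using ergodic Z unfolding relation_ergodic_def by (metis space_M)
qed

text \<open>Exchanging an initial path for one with the same end point, the same length and the same
  \<open>\<phi>\<close>-value is a holonomy of the tail relation.\<close>

lemma emeasure_prepend_same_data:
  assumes B [measurable]: "B \<in> sets M" and "B \<subseteq> cyl b"
    and "word_path A a v b" "word_path A a' w b" and same: "same_data v w"
  shows "emeasure M (prepend A v B) = emeasure M (prepend A w B)"
proof -
  define \<kappa> where "\<kappa> v w x = w \<frown> suffix (length v) x" for v w :: "'s list" and x :: "nat \<Rightarrow> 's"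
  have eqv: "prepend A v B = (\<frown>) v ` B" and eqw: "prepend A w B = (\<frown>) w ` B"
    using assms prepend_path_subset(1) by metis+
  have sub: "(\<frown>) v ` B \<subseteq> tms A" "(\<frown>) w ` B \<subseteq> tms A"
    using prepend_subset_tms[of A v B] prepend_subset_tms[of A w B] by (simp_all add: eqv eqw)
  have inj: "inj_on ((\<frown>) u) B" for u :: "'s list" by (auto simp: inj_on_def)
  have meas: "\<kappa> v w \<in> measurable (restrict_space M ((\<frown>) v ` B)) (restrict_space M ((\<frown>) w ` B))"
    if "(\<frown>) v ` B \<subseteq> tms A" "(\<frown>) w ` B \<subseteq> tms A" for v w :: "'s list"
  proof (rule measurable_restrict_space2)
    show "\<kappa> v w \<in> space (restrict_space M ((\<frown>) v ` B)) \<rightarrow> (\<frown>) w ` B"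
      by (auto simp: \<kappa>_def space_restrict_space)
    show "\<kappa> v w \<in> measurable (restrict_space M ((\<frown>) v ` B)) M"
    proof (rule measurable_into_M)
      show "\<kappa> v w \<in> space (restrict_space M ((\<frown>) v ` B)) \<rightarrow> tms A"
        using that by (auto simp: \<kappa>_def space_restrict_space)
      fix i
      show "(\<lambda>x. \<kappa> v w x i) \<in> measurable (restrict_space M ((\<frown>) v ` B)) (count_space UNIV)"
        by (intro measurable_restrict_space1, cases "i < length w") (simp_all add: \<kappa>_def)
    qed
  qed
  have bij: "bij_betw (\<kappa> v w) ((\<frown>) v ` B) ((\<frown>) w ` B)"
    by (rule bij_betwI[where g="\<kappa> w v"]) (auto simp: \<kappa>_def)
  have inv: "the_inv_into ((\<frown>) v ` B) (\<kappa> v w) y = \<kappa> w v y" if "y \<in> (\<frown>) w ` B" for y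
    by (rule the_inv_into_f_eq) (use that bij in \<open>auto simp: \<kappa>_def bij_betw_def\<close>)
  have "holonomy M (tail_relation A \<phi>) (\<kappa> v w) ((\<frown>) v ` B) ((\<frown>) w ` B)"
    unfolding holonomy_def
  proof (intro conjI ballI)
    show "(\<frown>) v ` B \<in> sets M" "(\<frown>) w ` B \<in> sets M"
      using prepend_in_sets[OF B] eqv eqw by metis+
    show "the_inv_into ((\<frown>) v ` B) (\<kappa> v w)
      \<in> measurable (restrict_space M ((\<frown>) w ` B)) (restrict_space M ((\<frown>) v ` B))"
      using meas[OF sub(2,1)] by (subst measurable_cong[where g="\<kappa> w v"])
        (auto simp: inv space_restrict_space)
    fix x assume "x \<in> (\<frown>) v ` B"
    then obtain z where z: "x = v \<frown> z" "z \<in> B" by auto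
    then show "(x, \<kappa> v w x) \<in> tail_relation A \<phi>"
      using tail_relation_conc[OF same, of z] sub by (auto simp: \<kappa>_def)
  qed (use bij meas sub in auto)
  then have "emeasure M (\<kappa> v w ` ((\<frown>) v ` B)) = emeasure M ((\<frown>) v ` B)"
    using invariant unfolding relation_invariant_def holonomy_def by blast
  moreover have "\<kappa> v w ` ((\<frown>) v ` B) = (\<frown>) w ` B"
    using bij by (simp add: bij_betw_def)
  ultimately show ?thesis by (simp add: eqv eqw)
qed

section \<open>Recurrence and transit\<close>

text \<open>The set of sequences that visit the state \<open>a\<close> infinitely often.\<close>

definition visits :: "'s \<Rightarrow> (nat \<Rightarrow> 's) set" where
  "visits a = {x \<in> tms A. \<forall>m. \<exists>n\<ge>m. x n = a}"

lemma visits_in_sets [measurable, simp]: "visits a \<in> sets M"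
proof -
  have "visits a = {x \<in> space M. \<forall>m. \<exists>n. n \<ge> m \<and> x n = a}"
    by (auto simp: visits_def)
  also have "\<dots> \<in> sets M" by measurable
  finally show ?thesis .
qed

lemma cyl_positive: "emeasure M (cyl a) > 0"
  using supported cyl_nonempty[of a] by (simp add: globally_supported_def)

lemma AE_visits_of_start: "AE x in M. x \<in> cyl a \<longrightarrow> x \<in> visits a"
proof -
  have "AE x in M. (\<Sum>n. indicator (cyl a) ((left_shift ^^ n) x) :: ennreal) \<in> {0, \<infinity>}"
    using recurrent by (auto simp: recurrent_def state_partition_def)
  then show ?thesis
  proof (rule AE_mp, intro AE_I2 impI)
    fix x assume x: "(\<Sum>n. indicator (cyl a) ((left_shift ^^ n) x) :: ennreal) \<in> {0, \<infinity>}" "x \<in> cyl a"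
    have eq: "(indicator (cyl a) ((left_shift ^^ n) x) :: ennreal) = (if x n = a then 1 else 0)" for n
      using x(2) tms_suffix[of x A n] by (auto simp: funpow_left_shift mem_cylinder_state indicator_def)
    have "x 0 = a" using x(2) by (simp add: mem_cylinder_state)
    then have ne: "(\<Sum>n. if x n = a then 1 else 0 :: ennreal) \<noteq> 0"
      by (subst suminf_eq_zero_iff) auto
    show "x \<in> visits a"
    proof (rule ccontr)
      assume "x \<notin> visits a"
      then obtain m where m: "\<And>n. n \<ge> m \<Longrightarrow> x n \<noteq> a"
        using x(2) by (auto simp: visits_def mem_cylinder_state)
      then have "(\<Sum>n. if x n = a then 1 else 0 :: ennreal) = (\<Sum>n<m. if x n = a then 1 else 0)"
        by (intro suminf_finite) (auto simp: not_less)
      also have "\<dots> \<le> (\<Sum>n<m. 1)" by (intro sum_mono) simp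
      also have "\<dots> < \<infinity>" by (simp add: of_nat_less_top)
      finally show False using ne x(1) by (auto simp: eq)
    qed
  qed
qed

text \<open>The set \<open>visits a\<close> is saturated, and by recurrence it contains almost all of \<open>[a]\<close>, so
  ergodicity makes it conull.\<close>

lemma visits_conull: "tms A - visits a \<in> null_sets M"
proof -
  have "visits a \<notin> null_sets M"
  proof
    assume "visits a \<in> null_sets M"
    then have "AE x in M. x \<notin> visits a" by (rule AE_not_in)
    with AE_visits_of_start[of a] have "AE x in M. x \<notin> cyl a" by eventually_elim auto
    then have "cyl a \<in> null_sets M" by (subst (asm) AE_iff_null_sets[symmetric]) auto
    then show False using cyl_positive[of a] by (simp add: null_sets_def)
  qed
  moreover have "visits a \<in> null_sets M \<or> tms A - visits a \<in> null_sets M"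
  proof (rule saturated_null_or_conull[OF visits_in_sets])
    fix x y assume xy: "x \<in> visits a" "(x, y) \<in> tail_relation A \<phi>"
    obtain n where n: "y \<in> tms A"
      "\<forall>m\<ge>n. suffix m x = suffix m y \<and> same_data (prefix m x) (prefix m y)"
      using xy(2) unfolding tail_relation_iff by blast
    have "\<exists>k\<ge>m. y k = a" for m
    proof -
      obtain k where k: "k \<ge> max m n" "x k = a" using \<open>x \<in> visits a\<close> unfolding visits_def by blast
      then have "suffix k x = suffix k y" using n(2) by simp
      from fun_cong[OF this, of 0] have "x k = y k" by simp
      then show ?thesis using k by (intro exI[of _ k]) simp
    qed
    then show "y \<in> visits a" using n(1) by (simp add: visits_def)
  qed
  ultimately show ?thesis by blast
qed

lemma AE_visits: "AE x in M. x \<in> visits a"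
  using AE_not_in[OF visits_conull[of a]] by (rule AE_mp) (auto intro!: AE_I2)

text \<open>By ergodicity the saturation of \<open>E\<close> is conull, so almost every point \<open>y\<close> of \<open>F\<close> is related to some
  \<open>x\<close> in \<open>E\<close>. From some time on the tails of \<open>x\<close> and \<open>y\<close> agree, and the common tail can be cut at a
  visit to \<open>a\<close> as late as desired. Countably many pairs of words occur, so one of them occurs on a
  set of positive measure.\<close>

lemma transit:
  assumes E [measurable]: "E \<in> sets M" "F \<in> sets M"
    and pos: "emeasure M E \<noteq> 0" "emeasure M F \<noteq> 0"
  obtains v w B where "same_data v w" "m \<le> length v" "B \<in> sets M" "B \<subseteq> cyl a" "B \<noteq> {}"
    "\<forall>z\<in>B. v \<frown> z \<in> E \<and> w \<frown> z \<in> F" "emeasure M (prepend A w B) \<noteq> 0"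
proof -
  define B where "B v w = {z \<in> tms A. v \<frown> z \<in> E} \<inter> {z \<in> tms A. w \<frown> z \<in> F} \<inter> cyl a" for v w
  have [measurable, simp]: "B v w \<in> sets M" for v w
    unfolding B_def by (intro sets.Int vimage_conc_in_sets) (use E in auto)
  \<comment> \<open>the saturation of \<open>E\<close>\<close>
  define Z where "Z = (\<Union>(v, w)\<in>{(v, w). same_data v w}. prepend A w {z \<in> tms A. v \<frown> z \<in> E})"
  have Z_iff: "y \<in> Z \<longleftrightarrow> (\<exists>x\<in>E. (x, y) \<in> tail_relation A \<phi>)" for y
  proof
    assume "y \<in> Z"
    then obtain v w z where "same_data v w" "v \<frown> z \<in> E" "y = w \<frown> z" "w \<frown> z \<in> tms A"
      by (auto simp: Z_def prepend_def)
    then show "\<exists>x\<in>E. (x, y) \<in> tail_relation A \<phi>"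
      using tail_relation_conc[of v w z] sets_subset_tms[OF E(1)] by blast
  next
    assume "\<exists>x\<in>E. (x, y) \<in> tail_relation A \<phi>"
    then obtain x n where x: "x \<in> E" "x \<in> tms A" "y \<in> tms A" "suffix n x = suffix n y"
      "same_data (prefix n x) (prefix n y)" unfolding tail_relation_iff by blast
    have "y \<in> prepend A (prefix n y) {z \<in> tms A. prefix n x \<frown> z \<in> E}"
      unfolding prepend_def mem_Collect_eq
    proof (intro exI[of _ "suffix n y"] conjI)
      show "suffix n y \<in> tms A" using x(3) by (rule tms_suffix)
      show "prefix n x \<frown> suffix n y \<in> E"
        unfolding x(4)[symmetric] using x(1) by simp
    qed (use x(3) in simp_all)
    then show "y \<in> Z" using x(5) unfolding Z_def by blast
  qed
  have Z: "Z \<in> sets M" unfolding Z_def by (intro sets.countable_UN'') auto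
  have "E \<subseteq> Z" using Z_iff tail_relation_refl sets_subset_tms[OF E(1)] by blast
  then have "Z \<notin> null_sets M"
    using pos(1) null_sets_subset[of Z M E] by (auto simp: null_sets_def)
  moreover have "y \<in> Z" if "x \<in> Z" "(x, y) \<in> tail_relation A \<phi>" for x y
    using that tail_relation_trans unfolding Z_iff by blast
  ultimately have "tms A - Z \<in> null_sets M" using saturated_null_or_conull[OF Z] by blast
  then have AE_Z: "AE x in M. x \<in> Z"
    by (rule AE_mp[OF AE_not_in]) (auto intro!: AE_I2)
  let ?I = "{(v, w). same_data v w \<and> m \<le> length v}"
  have "\<exists>(v, w)\<in>?I. emeasure M (prepend A w (B v w)) \<noteq> 0"
  proof (rule ccontr)
    assume "\<not> ?thesis"
    then have "\<forall>(v, w)\<in>?I. prepend A w (B v w) \<in> null_sets M" by (auto simp: null_sets_def)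
    then have "(\<Union>(v, w)\<in>?I. prepend A w (B v w)) \<in> null_sets M"
      by (intro null_sets_UN') auto
    then have "AE y in M. y \<notin> (\<Union>(v, w)\<in>?I. prepend A w (B v w))" by (rule AE_not_in)
    with AE_Z AE_visits[of a] have "AE y in M. y \<notin> F"
    proof eventually_elim
      case (elim y)
      show ?case
      proof
        assume "y \<in> F"
        obtain x n where x: "x \<in> E" "x \<in> tms A" "y \<in> tms A" 
          "\<forall>k\<ge>n. suffix k x = suffix k y \<and> same_data (prefix k x) (prefix k y)"
          using elim(1) unfolding tail_relation_iff Z_iff by blast
        obtain k where k: "k \<ge> max m n" "y k = a"
          using elim(2) unfolding visits_def by blast
        then have sxy: "suffix k x = suffix k y" and dxy: "same_data (prefix k x) (prefix k y)"
          using x(4) by simp_all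
        have "prefix k x \<frown> suffix k y \<in> E"
          unfolding sxy[symmetric] using x(1) by simp
        then have "suffix k y \<in> B (prefix k x) (prefix k y)"
          using k(2) \<open>y \<in> F\<close> tms_suffix[OF x(3), of k] by (simp add: B_def mem_cylinder_state)
        then have "y \<in> prepend A (prefix k y) (B (prefix k x) (prefix k y))"
          unfolding prepend_eq using x(3) by simp
        moreover have "(prefix k x, prefix k y) \<in> ?I" using dxy k(1) by simp
        ultimately show False using elim(3) by blast
      qed
    qed
    then have "F \<in> null_sets M" using E by (subst (asm) AE_iff_null_sets[symmetric]) auto
    then show False using pos(2) by (simp add: null_sets_def)
  qed
  then obtain v w where vw: "same_data v w" "m \<le> length v" "emeasure M (prepend A w (B v w)) \<noteq> 0"
    by blast
  show thesis
  proof (rule that[of v w "B v w"])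
    show "B v w \<noteq> {}" using vw(3) by (auto simp: prepend_def)
  qed (use vw in \<open>auto simp: B_def prepend_def\<close>)
qed

end

section \<open>First returns\<close>

context tail_ergodic_measure
begin

abbreviation loop :: "'s \<Rightarrow> 's list \<Rightarrow> bool" where
  "loop a w \<equiv> word_path A a w a"

lemma prepend_cyl: "prepend A w (cyl a) = cylinder A (w @ [a])"
proof -
  have "prefix (Suc (length w)) x = w @ [a] \<longleftrightarrow> prefix (length w) x = w \<and> x (length w) = a"
    for x :: "nat \<Rightarrow> 's"
    by simp
  then show ?thesis
    by (auto simp: prepend_eq mem_cylinder_iff tms_suffix)
qed

lemma prepend_cyl_positive:
  assumes "word_path A b w a" shows "emeasure M (prepend A w (cyl a)) \<noteq> 0"
proof -
  obtain z where "z \<in> cyl a" using cyl_nonempty by blast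
  then have "w \<frown> z \<in> prepend A w (cyl a)"
    using assms word_path_in_tms[of z A b w] by (auto simp: prepend_def mem_cylinder_state)
  then have "cylinder A (w @ [a]) \<noteq> {}" by (auto simp: prepend_cyl)
  then show ?thesis using supported
    by (auto simp: globally_supported_def prepend_cyl)
qed

lemma prepend_empty [simp]: "prepend A w {} = {}"
  by (simp add: prepend_def)

lemma prepend_Int: "prepend A w (B \<inter> C) = prepend A w B \<inter> prepend A w C"
  by (auto simp: prepend_eq)

lemma prepend_Diff: "prepend A w (B - C) = prepend A w B - prepend A w C"
  by (auto simp: prepend_eq)

lemma prepend_UN: "prepend A w (\<Union>i\<in>I. B i) = (\<Union>i\<in>I. prepend A w (B i))"
  by (auto simp: prepend_def)

text \<open>Although \<open>B \<mapsto> M (w B)\<close> need not be absolutely continuous, sets of sequences that visit \<open>a\<close> only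
  finitely often remain null when \<open>w\<close> is prepended.\<close>

lemma prepend_null:
  assumes "N \<in> sets M" "\<And>z. z \<in> N \<Longrightarrow> z \<notin> visits a"
  shows "emeasure M (prepend A w N) = 0"
proof -
  have "x \<notin> visits a" if "x \<in> prepend A w N" for x
  proof
    assume x: "x \<in> visits a"
    have z: "suffix (length w) x \<in> N" using that by (simp add: prepend_eq)
    have "\<exists>n\<ge>m. suffix (length w) x n = a" for m
    proof -
      obtain n where "n \<ge> m + length w" "x n = a" using x unfolding visits_def by blast
      then show ?thesis by (intro exI[of _ "n - length w"]) simp
    qed
    then have "suffix (length w) x \<in> visits a"
      using sets_subset_tms[OF assms(1)] z by (auto simp: visits_def)
    then show False using assms(2)[OF z] by simp
  qed
  then have "prepend A w N \<subseteq> tms A - visits a"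
    using prepend_subset_tms by blast
  then show ?thesis
    using null_sets_subset[OF visits_conull prepend_in_sets[OF assms(1)]] by (auto simp: null_sets_def)
qed

text \<open>\<open>first_return m a r\<close>: the word \<open>r\<close> is a loop at \<open>a\<close> which ends at the first visit to \<open>a\<close> at or
  after time \<open>m\<close>. These loops partition almost all of the partition set of \<open>a\<close>.\<close>

definition first_return :: "nat \<Rightarrow> 's \<Rightarrow> 's list \<Rightarrow> bool" where
  "first_return m a r \<longleftrightarrow> loop a r \<and> m \<le> length r \<and> (\<forall>i<length r. m \<le> i \<longrightarrow> r ! i \<noteq> a)"

text \<open>The first visit to \<open>a\<close> at or after time \<open>m\<close>; only meaningful if there is such a visit.\<close>

definition return_time :: "nat \<Rightarrow> 's \<Rightarrow> (nat \<Rightarrow> 's) \<Rightarrow> nat" where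
  "return_time m a x = (LEAST k. m \<le> k \<and> x k = a)"

lemma return_time_visits:
  assumes "x \<in> visits a"
  shows "m \<le> return_time m a x" "x (return_time m a x) = a"
    "m \<le> i \<Longrightarrow> i < return_time m a x \<Longrightarrow> x i \<noteq> a"
proof -
  obtain n where "m \<le> n \<and> x n = a" using assms unfolding visits_def by blast
  then have "m \<le> return_time m a x \<and> x (return_time m a x) = a"
    unfolding return_time_def by (rule LeastI)
  then show "m \<le> return_time m a x" "x (return_time m a x) = a" by auto
  show "m \<le> i \<Longrightarrow> i < return_time m a x \<Longrightarrow> x i \<noteq> a"
    unfolding return_time_def using not_less_Least by blast
qed

lemma first_return_prefix:
  assumes "x \<in> visits a" "x 0 = a"
  shows "first_return m a (prefix (return_time m a x) x)"
  using return_time_visits[OF assms(1), of m] prefix_word_path[of x A "return_time m a x"] assms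
  by (auto simp: first_return_def visits_def)

lemma return_time_first_return:
  assumes "first_return m a r" "z \<in> cyl a"
  shows "return_time m a (r \<frown> z) = length r"
  unfolding return_time_def
proof (rule Least_equality)
  show "m \<le> length r \<and> (r \<frown> z) (length r) = a"
    using assms by (simp add: first_return_def mem_cylinder_state)
  fix k assume k: "m \<le> k \<and> (r \<frown> z) k = a"
  show "length r \<le> k"
  proof (rule ccontr)
    assume "\<not> length r \<le> k"
    then have "r ! k = a" "k < length r" using k by simp_all
    then show False using assms(1) k unfolding first_return_def by blast
  qed
qed

lemma emeasure_first_return_partition:
  assumes C [measurable]: "C \<in> sets M" "C \<subseteq> cyl a"
  shows "emeasure M (prepend A v C) =
    (\<integral>\<^sup>+r. emeasure M (prepend A v (C \<inter> prepend A r (cyl a))) \<partial>count_space {r. first_return m a r})"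
proof -
  let ?R = "{r. first_return m a r}"
  let ?D = "\<lambda>r. prepend A v (C \<inter> prepend A r (cyl a))"
  have rD: "r = prefix (return_time m a x) x" if "x \<in> prepend A r (cyl a)" "r \<in> ?R" for r x
  proof -
    obtain z where z: "x = r \<frown> z" "z \<in> cyl a" using \<open>x \<in> prepend A r (cyl a)\<close>
      unfolding prepend_def by blast
    then show ?thesis using return_time_first_return[of m a r z] \<open>r \<in> ?R\<close> by simp
  qed
  have disj: "disjoint_family_on ?D ?R"
    unfolding disjoint_family_on_def
  proof (intro ballI impI)
    fix r q assume rq: "r \<in> ?R" "q \<in> ?R" "r \<noteq> q"
    have "\<not> (x \<in> prepend A r (cyl a) \<and> x \<in> prepend A q (cyl a))" for x
      using rD[of x r] rD[of x q] rq by metis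
    then have "C \<inter> prepend A r (cyl a) \<inter> (C \<inter> prepend A q (cyl a)) = {}" by blast
    then show "?D r \<inter> ?D q = {}" unfolding prepend_Int[symmetric] by (simp add: prepend_def)
  qed
  have sub: "(\<Union>r\<in>?R. ?D r) \<subseteq> prepend A v C"
    by (intro UN_least prepend_mono Int_lower1)
  have "(\<Union>r\<in>?R. ?D r) = prepend A v (C \<inter> (\<Union>r\<in>?R. prepend A r (cyl a)))"
    unfolding Int_UN_distrib prepend_UN by (rule refl)
  then have "prepend A v C - (\<Union>r\<in>?R. ?D r) \<subseteq> prepend A v (C - (\<Union>r\<in>?R. prepend A r (cyl a)))"
    by (simp only: prepend_Diff[symmetric] Diff_Int2 order_refl Diff_Int Diff_cancel Un_empty_left)
  moreover have "emeasure M (prepend A v (C - (\<Union>r\<in>?R. prepend A r (cyl a)))) = 0"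
  proof (rule prepend_null[of _ a])
    show "C - (\<Union>r\<in>?R. prepend A r (cyl a)) \<in> sets M"
      by (intro sets.Diff C sets.countable_UN'') auto
    fix z assume z: "z \<in> C - (\<Union>r\<in>?R. prepend A r (cyl a))"
    show "z \<notin> visits a"
    proof
      assume v: "z \<in> visits a"
      have z0: "z 0 = a" "z \<in> tms A" using z C(2) by (auto simp: mem_cylinder_state)
      let ?r = "prefix (return_time m a z) z"
      have "z \<in> prepend A ?r (cyl a)"
        using return_time_visits[OF v, of m] z0 by (simp add: prepend_eq mem_cylinder_state tms_suffix)
      then show False using z first_return_prefix[OF v z0(1), of m] by blast
    qed
  qed
  moreover have U: "(\<Union>r\<in>?R. prepend A r (cyl a)) \<in> sets M" "(\<Union>r\<in>?R. ?D r) \<in> sets M"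
    by (intro sets.countable_UN''; simp)+
  moreover have "prepend A v C - (\<Union>r\<in>?R. ?D r) \<in> sets M"
    by (rule sets.Diff[OF prepend_in_sets[OF C(1)] U(2)])
  moreover have "prepend A v (C - (\<Union>r\<in>?R. prepend A r (cyl a))) \<in> sets M"
    by (rule prepend_in_sets[OF sets.Diff[OF C(1) U(1)]])
  ultimately have null: "prepend A v C - (\<Union>r\<in>?R. ?D r) \<in> null_sets M"
    by (metis null_setsI null_sets_subset)
  have eq: "prepend A v C = (\<Union>r\<in>?R. ?D r) \<union> (prepend A v C - (\<Union>r\<in>?R. ?D r))"
    using sub by (simp only: Un_Diff_cancel Un_absorb1)
  have "emeasure M (prepend A v C) = emeasure M (\<Union>r\<in>?R. ?D r)"
    using arg_cong[OF eq, of "emeasure M"] emeasure_Un_null_set[OF U(2) null] by (rule trans)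
  also have "\<dots> = (\<integral>\<^sup>+r. emeasure M (?D r) \<partial>count_space ?R)"
    by (intro emeasure_UN_countable disj) auto
  finally show ?thesis .
qed

text \<open>The measure \<open>B \<mapsto> M (u B)\<close> restricted to \<open>[a]\<close>. The restriction matters, since the word \<open>u\<close> may
  also be followed by letters other than \<open>a\<close>.\<close>

definition loop_measure :: "'s \<Rightarrow> 's list \<Rightarrow> (nat \<Rightarrow> 's) measure" where
  "loop_measure a u = density (word_measure u) (indicator (cyl a))"

lemma sets_loop_measure [measurable_cong, simp]: "sets (loop_measure a u) = sets M"
  by (simp add: loop_measure_def)

lemma space_loop_measure [simp]: "space (loop_measure a u) = tms A"
  by (simp add: loop_measure_def)

lemma emeasure_loop_measure:
  "B \<in> sets M \<Longrightarrow> emeasure (loop_measure a u) B = emeasure M (prepend A u (cyl a \<inter> B))"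
  by (simp add: loop_measure_def emeasure_restricted emeasure_word_measure)

lemma emeasure_loop_measure':
  "B \<in> sets M \<Longrightarrow> B \<subseteq> cyl a \<Longrightarrow> emeasure (loop_measure a u) B = emeasure M (prepend A u B)"
  by (simp add: emeasure_loop_measure Int_absorb1)

lemma return_time_measurable [measurable]: "return_time m a \<in> measurable M (count_space UNIV)"
  unfolding return_time_def by measurable

lemma measurable_return_map [measurable]: "(\<lambda>x. suffix (return_time m a x) x) \<in> measurable M M"
  by (rule measurable_compose_countable[OF measurable_suffix return_time_measurable])

text \<open>Cutting a sequence at its first visit to \<open>a\<close> at or after time \<open>n\<close> preserves the measure \<open>B \<mapsto> M (u B)\<close> on
  \<open>[a]\<close>. Both sides are expanded into a double sum of the measures of \<open>u r q [a]\<close> and \<open>u q r [a]\<close>,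
  respectively, where \<open>r\<close> ends at that visit and the loop \<open>q\<close> extends the word
  \<open>w\<close> up to the next visit to \<open>a\<close>. The two words have the same data.\<close>

lemma return_map_invariant_cylinder:
  assumes u: "loop a u" and C: "C = cylinder A w" "C \<subseteq> cyl a"
  shows "emeasure M (prepend A u {x \<in> cyl a. suffix (return_time n a x) x \<in> C}) = emeasure M (prepend A u C)"
proof -
  let ?S = "\<lambda>x. suffix (return_time n a x) x"
  let ?R = "\<lambda>m. {r. first_return m a r}"
  define D where "D = {x \<in> cyl a. ?S x \<in> C}"
  have C' [measurable]: "C \<in> sets M" by (simp add: C)
  have "D = {x \<in> space M. x \<in> cyl a \<and> ?S x \<in> C}" by (auto simp: D_def mem_cylinder_state)
  also have "\<dots> \<in> sets M" by measurable
  finally have D [measurable]: "D \<in> sets M" .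
  have Dr: "D \<inter> prepend A r (cyl a) = prepend A r C" if r: "r \<in> ?R n" for r
  proof -
    have "r \<frown> z \<in> D \<longleftrightarrow> z \<in> C" if "z \<in> cyl a" for z
    proof -
      have "?S (r \<frown> z) = z" using return_time_first_return[of n a r z] r that by simp
      moreover have "r \<frown> z \<in> cyl a"
        using prepend_path_subset[of "{z}" A a a r] r that
        by (auto simp: first_return_def)
      ultimately show ?thesis by (simp add: D_def)
    qed
    then show ?thesis using C(2) by (auto simp: prepend_def)
  qed
  have Cq: "C \<inter> prepend A q (cyl a) = (if take (length w) q = w then prepend A q (cyl a) else {})"
    if q: "q \<in> ?R (length w)" for q
  proof -
    have "prefix (length w) (q \<frown> z) = take (length w) q" for z
      using q by (simp add: first_return_def)
    then show ?thesis by (auto simp: C mem_cylinder_iff prepend_def)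
  qed
  have exchange: "emeasure M (prepend A (u @ r) (C \<inter> prepend A q (cyl a))) =
      emeasure M (prepend A (u @ q) (if take (length w) q = w then prepend A r (cyl a) else {}))"
    if "r \<in> ?R n" "q \<in> ?R (length w)" for r q
  proof (cases "take (length w) q = w")
    case True
    have "emeasure M (prepend A (u @ r @ q) (cyl a)) = emeasure M (prepend A (u @ q @ r) (cyl a))"
      using that u by (intro emeasure_prepend_same_data[of _ a a _ a])
        (auto simp: first_return_def same_data_def intro!: word_path_appendI)
    then show ?thesis using True by (simp add: Cq[OF that(2)] flip: prepend_append)
  qed (simp add: Cq[OF that(2)])
  have "emeasure M (prepend A u D) = (\<integral>\<^sup>+r. emeasure M (prepend A (u @ r) C) \<partial>count_space (?R n))"
    by (subst emeasure_first_return_partition[OF D, of a _ n])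
      (auto simp: D_def Dr[unfolded D_def] prepend_append intro!: nn_integral_cong)
  also have "\<dots> = (\<integral>\<^sup>+r. \<integral>\<^sup>+q. emeasure M (prepend A (u @ r) (C \<inter> prepend A q (cyl a)))
      \<partial>count_space (?R (length w)) \<partial>count_space (?R n))"
    by (subst emeasure_first_return_partition[OF C' C(2), of _ "length w"]) simp
  also have "\<dots> = (\<integral>\<^sup>+r. \<integral>\<^sup>+q. emeasure M (prepend A (u @ q) (if take (length w) q = w then prepend A r (cyl a) else {}))
      \<partial>count_space (?R (length w)) \<partial>count_space (?R n))"
    by (rule nn_integral_cong, rule nn_integral_cong, rule exchange) simp_all
  also have "\<dots> = (\<integral>\<^sup>+q. \<integral>\<^sup>+r. emeasure M (prepend A (u @ q) (if take (length w) q = w then prepend A r (cyl a) else {}))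
      \<partial>count_space (?R n) \<partial>count_space (?R (length w)))"
    by (rule nn_integral_count_space_nn_integral) auto
  also have "\<dots> = (\<integral>\<^sup>+q. emeasure M (prepend A u (C \<inter> prepend A q (cyl a))) \<partial>count_space (?R (length w)))"
  proof (intro nn_integral_cong)
    fix q assume "q \<in> space (count_space (?R (length w)))"
    then have q: "q \<in> ?R (length w)" by simp
    show "(\<integral>\<^sup>+r. emeasure M (prepend A (u @ q) (if take (length w) q = w then prepend A r (cyl a) else {}))
      \<partial>count_space (?R n)) = emeasure M (prepend A u (C \<inter> prepend A q (cyl a)))"
    proof (cases "take (length w) q = w")
      case True
      have "cyl a \<inter> prepend A r (cyl a) = prepend A r (cyl a)" if "r \<in> ?R n" for r
        using prepend_path_subset(2)[of "cyl a" A a a r] that by (auto simp: first_return_def)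
      then have "(\<integral>\<^sup>+r. emeasure M (prepend A (u @ q) (prepend A r (cyl a))) \<partial>count_space (?R n))
        = emeasure M (prepend A (u @ q) (cyl a))"
        by (subst emeasure_first_return_partition[of "cyl a" a "u @ q" n]) (auto intro!: nn_integral_cong)
      then show ?thesis by (simp add: True Cq[OF q] prepend_append)
    qed (simp add: Cq[OF q])
  qed
  also have "\<dots> = emeasure M (prepend A u C)"
    by (rule emeasure_first_return_partition[OF C' C(2), symmetric])
  finally show ?thesis by (simp add: D_def)
qed

end

section \<open>Scaling of loops\<close>

context tail_ergodic_measure
begin

lemma loop_prepend_subset: "loop a u \<Longrightarrow> B \<subseteq> cyl a \<Longrightarrow> prepend A u B \<subseteq> cyl a"
  using prepend_path_subset(2)[of B A a a u] by simp

lemma loop_measure_return_invariant: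
  assumes u: "loop a u" and fin: "emeasure M (prepend A u (cyl a)) < \<infinity>"
  shows "distr (loop_measure a u) M (\<lambda>x. suffix (return_time n a x) x) = loop_measure a u"
    (is "distr ?N M ?S = ?N")
proof -
  define E where "E = insert {} {cylinder A w |w. w \<noteq> []}"
  have S: "?S \<in> measurable ?N M"
    using measurable_return_map[of n a] measurable_cong_sets[of ?N M M M] by simp
  have finN: "emeasure ?N B \<noteq> \<infinity>" if "B \<in> sets M" for B
  proof -
    have "emeasure ?N B \<le> emeasure M (prepend A u (cyl a))"
      unfolding emeasure_loop_measure[OF that]
      by (intro emeasure_mono prepend_mono prepend_in_sets) auto
    then show ?thesis using fin by auto
  qed
  have eq: "emeasure ?N C = emeasure (distr ?N M ?S) C" if CE: "C \<in> E" for C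
  proof -
    have C: "C \<in> sets M" using CE by (auto simp: E_def)
    have SC: "?S -` C \<inter> tms A \<in> sets M"
      using measurable_sets[OF measurable_return_map C, of n a] by simp
    have dist: "emeasure (distr ?N M ?S) C = emeasure M (prepend A u (cyl a \<inter> (?S -` C \<inter> tms A)))"
      by (simp add: emeasure_distr[OF S C] emeasure_loop_measure[OF SC])
    show ?thesis
    proof (cases "C \<subseteq> cyl a")
      case True
      have "cyl a \<inter> (?S -` C \<inter> tms A) = {x \<in> cyl a. ?S x \<in> C}"
        by (auto simp: mem_cylinder_state)
      moreover have "emeasure M (prepend A u {x \<in> cyl a. ?S x \<in> C}) = emeasure M (prepend A u C)"
      proof (cases "C = {}")
        case False
        then obtain w where "C = cylinder A w" using CE by (auto simp: E_def)
        then show ?thesis by (rule return_map_invariant_cylinder[OF u _ True])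
      qed simp
      ultimately show ?thesis using C True by (simp add: dist emeasure_loop_measure')
    next
      case False
      then obtain w where w: "C = cylinder A w" "w \<noteq> []" using CE by (auto simp: E_def)
      have C0: "x 0 = w ! 0" if "x \<in> C" for x
        using that w by (auto simp: cylinder_def)
      have "w ! 0 \<noteq> a"
      proof
        assume "w ! 0 = a"
        then have "C \<subseteq> cyl a" using C0 sets_subset_tms[OF C] by (auto simp: mem_cylinder_state)
        then show False using False by simp
      qed
      then have "cyl a \<inter> C = {}" using C0 by (auto simp: mem_cylinder_state)
      then have "emeasure ?N C = 0" using C by (simp add: emeasure_loop_measure)
      moreover have "emeasure M (prepend A u (cyl a \<inter> (?S -` C \<inter> tms A))) = 0"
      proof (rule prepend_null[of _ a])
        show "cyl a \<inter> (?S -` C \<inter> tms A) \<in> sets M" using SC by simp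
        fix z assume z: "z \<in> cyl a \<inter> (?S -` C \<inter> tms A)"
        show "z \<notin> visits a"
        proof
          assume "z \<in> visits a"
          then have "?S z 0 = a" using return_time_visits(2)[of z a n] by simp
          then show False using z C0[of "?S z"] \<open>w ! 0 \<noteq> a\<close> by simp
        qed
      qed
      ultimately show ?thesis by (simp add: dist)
    qed
  qed
  have "?N = distr ?N M ?S"
  proof (rule measure_eqI_generator_eq_countable[where E=E and \<Omega>="tms A" and A="range cyl"])
    show "Int_stable E"
    proof (rule Int_stableI)
      fix U V assume "U \<in> E" "V \<in> E"
      show "U \<inter> V \<in> E"
      proof (cases "U \<inter> V = {}")
        case True then show ?thesis by (simp add: E_def)
      next
        case False
        then obtain v w x where vw: "U = cylinder A v" "v \<noteq> []" "V = cylinder A w" "w \<noteq> []" "x \<in> U" "x \<in> V"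
          using \<open>U \<in> E\<close> \<open>V \<in> E\<close> unfolding E_def by blast
        have x: "prefix (length v) x = v" "prefix (length w) x = w"
          using vw by (simp_all only: mem_cylinder_iff)
        have "cylinder A v \<inter> cylinder A w = cylinder A (prefix (max (length v) (length w)) x)"
          unfolding cylinder_prefix cylinder_prefix[where A=A and n="length v" and x=x, unfolded x]
            cylinder_prefix[where A=A and n="length w" and x=x, unfolded x] by (auto simp: less_max_iff_disj)
        moreover have "prefix (max (length v) (length w)) x \<noteq> []" using vw by simp
        ultimately show ?thesis unfolding E_def vw by blast
      qed
    qed
    show "E \<subseteq> Pow (tms A)" by (auto simp: E_def cylinder_def)
    have "sigma_sets (tms A) E = sigma_sets (tms A) {cylinder A w |w. w \<noteq> []}"
      by (rule sigma_sets_eqI) (auto simp: E_def sigma_sets.Empty)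
    then show "sets ?N = sigma_sets (tms A) E" "sets (distr ?N M ?S) = sigma_sets (tms A) E"
      by (simp_all add: sets_M_generated)
    show "range cyl \<subseteq> E" by (auto simp: E_def)
    show "\<Union>(range cyl) = tms A" by (auto simp: mem_cylinder_state)
  qed (use eq finN in auto)
  then show ?thesis by simp
qed

text \<open>The loop \<open>e\<close> ends at the first visit to \<open>a\<close> at or after time \<open>length e\<close>. Hence \<open>e B\<close> is contained in
  the preimage of \<open>B\<close> under the measure preserving return map.\<close>

lemma loop_measure_append_le:
  assumes u: "loop a u" and fin: "emeasure M (prepend A u (cyl a)) < \<infinity>" and e: "loop a e"
    and B: "B \<in> sets M" "B \<subseteq> cyl a"
  shows "emeasure M (prepend A (u @ e) B) \<le> emeasure M (prepend A u B)"
proof -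
  let ?n = "length e" and ?N = "loop_measure a u"
  let ?S = "\<lambda>x. suffix (return_time ?n a x) x"
  have S: "?S \<in> measurable ?N M"
    using measurable_return_map[of ?n a] measurable_cong_sets[of ?N M M M] by simp
  have SB: "?S -` B \<inter> tms A \<in> sets M"
    using measurable_sets[OF measurable_return_map B(1), of ?n a] by simp
  have "first_return ?n a e" using e by (simp add: first_return_def)
  then have "?S (e \<frown> z) = z" if "z \<in> B" for z
    using return_time_first_return[of ?n a e z] that B(2) by auto
  then have "prepend A e B \<subseteq> ?S -` B \<inter> tms A" by (auto simp: prepend_def)
  moreover have "prepend A e B \<subseteq> cyl a" using loop_prepend_subset[OF e B(2)] .
  ultimately have "prepend A e B \<subseteq> cyl a \<inter> (?S -` B \<inter> tms A)" by blast
  then have "emeasure M (prepend A (u @ e) B) \<le> emeasure M (prepend A u (cyl a \<inter> (?S -` B \<inter> tms A)))"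
    unfolding prepend_append using SB by (intro emeasure_mono prepend_mono) auto
  also have "\<dots> = emeasure (distr ?N M ?S) B"
    by (simp add: emeasure_distr[OF S B(1)] emeasure_loop_measure[OF SB])
  also have "\<dots> = emeasure M (prepend A u B)"
    by (simp add: loop_measure_return_invariant[OF u fin] emeasure_loop_measure' B)
  finally show ?thesis .
qed

text \<open>The density of \<open>B \<mapsto> M (u e B)\<close> with respect to \<open>B \<mapsto> M (u B)\<close> is constant: otherwise the sets where
  it is larger and where it is at most its mean value \<open>c\<close> both have positive measure, and \<open>transit\<close>
  produces a subset of each of them such that either measure takes the same value on both subsets,
  which is absurd.\<close>

lemma loop_scaling_relative:
  assumes u: "loop a u" and fin: "emeasure M (prepend A u (cyl a)) < \<infinity>" and e: "loop a e"
  shows "\<exists>c>0. c \<noteq> \<infinity> \<and> (\<forall>B\<in>sets M. B \<subseteq> cyl a \<longrightarrow>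
    emeasure M (prepend A (u @ e) B) = c * emeasure M (prepend A u B))"
proof -
  let ?N = "loop_measure a u" and ?L = "loop_measure a (u @ e)"
  have ue: "loop a (u @ e)" using u e by (rule word_path_appendI)
  have finN: "emeasure ?N B < \<infinity>" if "B \<in> sets M" for B
  proof -
    have "emeasure ?N B \<le> emeasure M (prepend A u (cyl a))"
      unfolding emeasure_loop_measure[OF that]
      by (intro emeasure_mono prepend_mono prepend_in_sets) auto
    then show ?thesis using fin by (rule le_less_trans)
  qed
  have le: "emeasure ?L B \<le> emeasure ?N B" if B: "B \<in> sets M" for B
    using loop_measure_append_le[OF u fin e, of "cyl a \<inter> B"] B
    by (simp add: emeasure_loop_measure)
  interpret N: finite_measure ?N
    by (rule finite_measureI) (use finN[of "tms A"] in auto)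
  have "emeasure ?L B = 0" if "B \<in> sets M" "emeasure ?N B = 0" for B
    using le[OF that(1)] that(2) by simp
  then have "absolutely_continuous ?N ?L"
    by (auto simp: absolutely_continuous_def null_sets_def)
  then obtain g where g0: "g \<in> borel_measurable ?N" and dens: "density ?N g = ?L"
    using N.Radon_Nikodym[of ?L] by auto
  have g [measurable]: "g \<in> borel_measurable M"
    using g0 measurable_cong_sets[of ?N M borel borel] by simp
  have L: "emeasure ?L B = (\<integral>\<^sup>+x. g x * indicator B x \<partial>?N)" if "B \<in> sets M" for B
    using that emeasure_density[OF g0, of B] by (simp add: dens)
  \<comment> \<open>the only possible value of the constant, as found by evaluating at \<open>[a]\<close>\<close>
  define c where "c = emeasure ?L (cyl a) / emeasure ?N (cyl a)"
  have Npos: "emeasure ?N (cyl a) \<noteq> 0" and Lpos: "emeasure ?L (cyl a) \<noteq> 0"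
    using prepend_cyl_positive[OF u] prepend_cyl_positive[OF ue] by (simp_all add: emeasure_loop_measure)
  have Lfin: "emeasure ?L B < \<infinity>" if "B \<in> sets M" for B
    using le[OF that] finN[OF that] by (rule le_less_trans)
  have Ncompl: "emeasure ?N (tms A - cyl a) = 0" 
    by (simp add: emeasure_loop_measure)
  have Ntot: "emeasure ?N (tms A) = emeasure ?N (cyl a)"
    and Ltot: "emeasure ?L (tms A) = emeasure ?L (cyl a)"
    by (simp_all add: emeasure_loop_measure Int_absorb2 sets_subset_tms)
  have cN: "c * emeasure ?N (tms A) = emeasure ?L (tms A)"
    unfolding c_def Ntot Ltot using Npos finN[of "cyl a"]
    by (simp add: ennreal_divide_times ennreal_divide_self)
  have cfin: "c \<noteq> \<infinity>" "c > 0"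
    unfolding c_def using Npos Lpos finN[of "cyl a"] Lfin[of "cyl a"]
    by (auto simp: ennreal_divide_eq_top_iff ennreal_zero_less_divide zero_less_iff_neq_zero)
  have AE_cyl: "AE x in ?N. x \<in> cyl a"
    by (rule AE_I[where N="tms A - cyl a"]) (use Ncompl in auto)
  have total: "(\<integral>\<^sup>+x. g x \<partial>?N) = (\<integral>\<^sup>+x. c \<partial>?N)"
    using L[of "tms A"] cN by (simp cong: nn_integral_cong_simp)
  have gfin: "(\<integral>\<^sup>+x. g x \<partial>?N) \<noteq> \<infinity>"
    unfolding total using cfin finN[of "tms A"] by (simp add: ennreal_mult_eq_top_iff)
  have one_sided: "(AE x in ?N. g x \<le> c) \<or> (AE x in ?N. c < g x)"
  proof (rule ccontr)
    assume not: "\<not> ?thesis"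
    define E1 where "E1 = {x \<in> cyl a. c < g x}"
    define E2 where "E2 = {x \<in> cyl a. g x \<le> c}"
    have "E1 = {x \<in> space M. x \<in> cyl a \<and> c < g x}" "E2 = {x \<in> space M. x \<in> cyl a \<and> g x \<le> c}"
      by (auto simp: E1_def E2_def mem_cylinder_state)
    moreover have "{x \<in> space M. x \<in> cyl a \<and> c < g x} \<in> sets M" "{x \<in> space M. x \<in> cyl a \<and> g x \<le> c} \<in> sets M"
      by measurable
    ultimately have E: "E1 \<in> sets M" "E2 \<in> sets M" by simp_all
    have sub: "E1 \<subseteq> cyl a" "E2 \<subseteq> cyl a" by (auto simp: E1_def E2_def)
    have "emeasure ?N E1 \<noteq> 0"
    proof
      assume "emeasure ?N E1 = 0"
      then have "AE x in ?N. x \<notin> E1" using E by (intro AE_not_in null_setsI) auto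
      with AE_cyl have "AE x in ?N. g x \<le> c" by eventually_elim (auto simp: E1_def)
      then show False using not by simp
    qed
    moreover have "emeasure ?N E2 \<noteq> 0"
    proof
      assume "emeasure ?N E2 = 0"
      then have "AE x in ?N. x \<notin> E2" using E by (intro AE_not_in null_setsI) auto
      with AE_cyl have "AE x in ?N. c < g x" by eventually_elim (auto simp: E2_def)
      then show False using not by simp
    qed
    ultimately have pos: "emeasure M (prepend A u E1) \<noteq> 0" "emeasure M (prepend A u E2) \<noteq> 0"
      using E sub by (simp_all add: emeasure_loop_measure')
    obtain v w B where vw: "same_data v w" "length u \<le> length v"
      and B: "B \<in> sets M" "B \<subseteq> cyl a" "B \<noteq> {}"
      and in12: "\<forall>z\<in>B. v \<frown> z \<in> prepend A u E1 \<and> w \<frown> z \<in> prepend A u E2"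
      and Bpos: "emeasure M (prepend A w B) \<noteq> 0"
      by (rule transit[OF prepend_in_sets[OF E(1)] prepend_in_sets[OF E(2)] pos,
            where m="length u" and a=a]) blast
    have split: "\<exists>v1. v = u @ v1 \<and> (\<forall>z\<in>B. v1 \<frown> z \<in> F)"
      if len: "length u \<le> length v" and F: "\<And>z. z \<in> B \<Longrightarrow> v \<frown> z \<in> prepend A u F" for v F
    proof (intro exI conjI ballI)
      obtain z0 where "z0 \<in> B" using B(3) by blast
      then have "prefix (length u) (v \<frown> z0) = u" using F[of z0] by (simp add: prepend_eq)
      then have "take (length u) v = u" using len by simp
      then show "v = u @ drop (length u) v" by (metis append_take_drop_id)
      fix z assume "z \<in> B"
      then show "drop (length u) v \<frown> z \<in> F" using F[of z] len by (simp add: prepend_eq)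
    qed
    obtain v1 where v1: "v = u @ v1" "\<forall>z\<in>B. v1 \<frown> z \<in> E1" using split[OF vw(2), of E1] in12 by blast
    have "length u \<le> length w" using vw by (simp add: same_data_def)
    then obtain w1 where w1: "w = u @ w1" "\<forall>z\<in>B. w1 \<frown> z \<in> E2" using split[of w E2] in12 by blast
    have path: "loop a y" if "\<forall>z\<in>B. y \<frown> z \<in> F" "F \<subseteq> cyl a" for y F
    proof -
      obtain z0 where z0: "z0 \<in> B" using B(3) by blast
      then have "z0 \<in> tms A" "z0 0 = a" "y \<frown> z0 \<in> tms A" "(y \<frown> z0) 0 = a"
        using that B(2) by (auto simp: mem_cylinder_state)
      then show ?thesis using tms_conc[of z0 A y] by simp
    qed
    have l1: "loop a v1" "loop a w1" using path[OF v1(2) sub(1)] path[OF w1(2) sub(2)] by auto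
    have sd: "same_data v1 w1" using vw(1) by (simp add: v1(1) w1(1) same_data_def)
    define P1 P2 where "P1 = prepend A v1 B" and "P2 = prepend A w1 B"
    have P: "P1 \<in> sets M" "P2 \<in> sets M" "P1 \<subseteq> E1" "P2 \<subseteq> E2"
      using prepend_in_sets[OF B(1)] v1(2) w1(2) unfolding P1_def P2_def
      by (simp_all add: prepend_def) blast+
    have P': "P1 \<subseteq> cyl a" "P2 \<subseteq> cyl a" using P sub by auto
    have "emeasure ?N P1 = emeasure M (prepend A (u @ v1) B)" "emeasure ?N P2 = emeasure M (prepend A (u @ w1) B)"
      using P P' by (simp_all add: emeasure_loop_measure' P1_def P2_def prepend_append)
    moreover have "emeasure M (prepend A (u @ v1) B) = emeasure M (prepend A (u @ w1) B)"
      by (rule emeasure_prepend_same_data[OF B(1,2) word_path_appendI[OF u l1(1)]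
          word_path_appendI[OF u l1(2)] same_data_append[OF same_data_refl sd]])
    ultimately have N12: "emeasure ?N P1 = emeasure ?N P2" "emeasure ?N P2 \<noteq> 0"
      using Bpos by (simp_all add: w1(1))
    have "emeasure ?L P1 = emeasure M (prepend A ((u @ e) @ v1) B)" "emeasure ?L P2 = emeasure M (prepend A ((u @ e) @ w1) B)"
      using P P' by (simp_all add: emeasure_loop_measure' P1_def P2_def prepend_append)
    moreover have "emeasure M (prepend A ((u @ e) @ v1) B) = emeasure M (prepend A ((u @ e) @ w1) B)"
      by (rule emeasure_prepend_same_data[OF B(1,2) word_path_appendI[OF ue l1(1)]
          word_path_appendI[OF ue l1(2)] same_data_append[OF same_data_refl sd]])
    ultimately have L12: "emeasure ?L P1 = emeasure ?L P2" by simp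
    have "c * emeasure ?N P1 < emeasure ?L P1"
    proof -
      have PN: "P1 \<in> sets ?N" using P by simp
      have "(\<integral>\<^sup>+x. c * indicator P1 x \<partial>?N) < (\<integral>\<^sup>+x. g x * indicator P1 x \<partial>?N)"
      proof (rule nn_integral_less)
        show "(\<lambda>x. c * indicator P1 x) \<in> borel_measurable ?N" "(\<lambda>x. g x * indicator P1 x) \<in> borel_measurable ?N"
          using PN g0 by measurable
        show "(\<integral>\<^sup>+x. c * indicator P1 x \<partial>?N) \<noteq> \<infinity>"
          using PN cfin finN[OF P(1)] by (simp add: nn_integral_cmult_indicator ennreal_mult_eq_top_iff)
        show "AE x in ?N. c * indicator P1 x \<le> g x * indicator P1 x"
          using P(3) by (intro AE_I2) (auto simp: E1_def indicator_def)
        show "\<not> (AE x in ?N. g x * indicator P1 x \<le> c * indicator P1 x)"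
        proof
          assume "AE x in ?N. g x * indicator P1 x \<le> c * indicator P1 x"
          then have "AE x in ?N. x \<notin> P1"
            by eventually_elim (use P(3) in \<open>auto simp: E1_def indicator_def split: if_splits\<close>)
          then have "P1 \<in> null_sets ?N" using PN by (simp add: AE_iff_null_sets)
          then show False using N12 by (simp add: null_sets_def)
        qed
      qed
      then show ?thesis using PN by (simp add: L[OF P(1)] nn_integral_cmult_indicator)
    qed
    also have "emeasure ?L P1 \<le> c * emeasure ?N P1"
    proof -
      have PN: "P2 \<in> sets ?N" using P by simp
      have "emeasure ?L P2 \<le> (\<integral>\<^sup>+x. c * indicator P2 x \<partial>?N)"
        unfolding L[OF P(2)] using P(4) by (intro nn_integral_mono) (auto simp: E2_def indicator_def)
      then show ?thesis using PN by (simp add: L12 N12 nn_integral_cmult_indicator)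
    qed
    finally show False by simp
  qed
  have cm: "(\<lambda>x. c) \<in> borel_measurable ?N" by simp
  have AE_eq: "AE x in ?N. g x = c"
    using one_sided
  proof
    assume le: "AE x in ?N. g x \<le> c"
    have "AE x in ?N. c \<le> g x"
      using nn_integral_less[OF g0 cm gfin le] total by auto
    with le show ?thesis by eventually_elim simp
  next
    assume "AE x in ?N. c < g x"
    then have le: "AE x in ?N. c \<le> g x" by eventually_elim simp
    have "AE x in ?N. g x \<le> c"
      using nn_integral_less[OF cm g0 _ le] gfin total by auto
    with le show ?thesis by eventually_elim simp
  qed
  have "emeasure M (prepend A (u @ e) B) = c * emeasure M (prepend A u B)"
    if B: "B \<in> sets M" "B \<subseteq> cyl a" for B
  proof -
    have "emeasure ?L B = (\<integral>\<^sup>+x. c * indicator B x \<partial>?N)"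
      unfolding L[OF B(1)] using AE_eq by (intro nn_integral_cong_AE) auto
    also have "\<dots> = c * emeasure ?N B" using B by (simp add: nn_integral_cmult_indicator)
    finally show ?thesis using B by (simp add: emeasure_loop_measure')
  qed
  then show ?thesis using cfin by blast
qed

end

section \<open>Finiteness on partition sets\<close>

lemma emeasure_UN_le_of_le_on_subsets:
  fixes C :: "'i::countable \<Rightarrow> 'a set"
  assumes sets: "sets N = sets M" and C: "\<And>i. C i \<in> sets M"
    and le: "\<And>i B. B \<in> sets M \<Longrightarrow> B \<subseteq> C i \<Longrightarrow> emeasure M B \<le> emeasure N B"
  shows "emeasure M (\<Union>i. C i) \<le> emeasure N (\<Union>i. C i)"
proof -
  define D where "D i = C i - (\<Union>j\<in>{j. to_nat j < to_nat i}. C j)" for i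
  have D: "D i \<in> sets M" for i
    unfolding D_def by (intro sets.Diff C sets.countable_UN'') auto
  have disj: "disjoint_family D"
    unfolding disjoint_family_on_def
  proof (intro ballI impI)
    fix i j :: 'i assume "i \<noteq> j"
    then have "to_nat i < to_nat j \<or> to_nat j < to_nat i" by (metis linorder_neqE_nat injD inj_to_nat)
    then show "D i \<inter> D j = {}" unfolding D_def by blast
  qed
  have UN: "(\<Union>i. C i) = (\<Union>i. D i)"
  proof
    show "(\<Union>i. C i) \<subseteq> (\<Union>i. D i)"
    proof
      fix x assume "x \<in> (\<Union>i. C i)"
      then obtain i where "x \<in> C i" by blast
      then obtain j where j: "x \<in> C j" "\<And>k. to_nat k < to_nat j \<Longrightarrow> x \<notin> C k"
        using ex_has_least_nat[of "\<lambda>i. x \<in> C i" i to_nat]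
        by (metis not_less)
      then show "x \<in> (\<Union>i. D i)" unfolding D_def by blast
    qed
  qed (auto simp: D_def)
  have "emeasure M (\<Union>i. D i) = (\<integral>\<^sup>+i. emeasure M (D i) \<partial>count_space UNIV)"
    using D disj by (intro emeasure_UN_countable) auto
  also have "\<dots> \<le> (\<integral>\<^sup>+i. emeasure N (D i) \<partial>count_space UNIV)"
    using D by (intro nn_integral_mono le) (auto simp: D_def)
  also have "\<dots> = emeasure N (\<Union>i. D i)"
    using D disj sets by (intro emeasure_UN_countable[symmetric]) auto
  finally show ?thesis by (simp add: UN)
qed

context tail_ergodic_measure
begin

lemma openin_in_sets:
  assumes "openin (tms_topology A) U" shows "U \<in> sets M"
proof -
  have "{U. openin (tms_topology A) U} \<subseteq> Pow (tms A)"
    using openin_tms_topologyD[of A] by blast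
  then have "sets M = sigma_sets (tms A) {U. openin (tms_topology A) U}"
    unfolding sets_M tms_borel_def by (rule sets_measure_of)
  then show ?thesis using assms by simp
qed

text \<open>A point of \<open>[a]\<close> that returns to \<open>a\<close> infinitely often has a cylinder neighbourhood of finite measure,
  which may be chosen to end in \<open>a\<close>.\<close>

lemma exists_finite_loop: "\<exists>u. loop a u \<and> emeasure M (prepend A u (cyl a)) < \<infinity>"
proof -
  have "\<not> cyl a \<subseteq> tms A - visits a"
  proof
    assume "cyl a \<subseteq> tms A - visits a"
    then have "cyl a \<in> null_sets M"
      by (rule null_sets_subset[OF visits_conull cylinder_in_sets])
    then show False using cyl_positive[of a] by (simp add: null_sets_def)
  qed
  then obtain x where "x \<in> cyl a" "x \<notin> tms A - visits a" by blast
  then have x: "x \<in> tms A" "x 0 = a" "x \<in> visits a"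
    by (simp_all add: mem_cylinder_state)
  obtain U where U: "openin (tms_topology A) U" "emeasure M U < \<infinity>" "x \<in> U"
    using loc_finite x(1) unfolding locally_finite_def by blast
  obtain n where n: "cylinder A (prefix (Suc n) x) \<subseteq> U"
    using openin_tms_topologyD[OF U(1,3)] by blast
  obtain k where k: "k \<ge> Suc n" "x k = a" using x(3) unfolding visits_def by blast
  have "prepend A (prefix k x) (cyl a) \<subseteq> cylinder A (prefix k x)"
    by (auto simp: prepend_eq mem_cylinder_iff)
  also have "\<dots> \<subseteq> cylinder A (prefix (Suc n) x)"
    unfolding cylinder_prefix using k(1) by auto
  finally have "emeasure M (prepend A (prefix k x) (cyl a)) \<le> emeasure M U"
    using n openin_in_sets[OF U(1)] by (intro emeasure_mono) auto
  then have "emeasure M (prepend A (prefix k x) (cyl a)) < \<infinity>"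
    using U(2) by (rule le_less_trans)
  moreover have "loop a (prefix k x)" using prefix_word_path[OF x(1), of k] x(2) k(2) by simp
  ultimately show ?thesis by blast
qed

lemma word_path_of_conc:
  assumes "z \<in> cyl a" "v \<frown> z \<in> cyl b" shows "word_path A b v a"
proof -
  have *: "z \<in> tms A" "z 0 = a" "v \<frown> z \<in> tms A" "(v \<frown> z) 0 = b"
    using assms unfolding mem_cylinder_state by blast+
  show ?thesis using *(3) unfolding tms_conc[OF *(1)] *(2) *(4) .
qed

lemma mem_prepend_conc_append:
  assumes "v \<frown> z \<in> prepend A u C" "length u \<le> length v"
  obtains v1 where "v = u @ v1" "v1 \<frown> z \<in> C"
proof -
  have "take (length u) v = u" using assms by (simp add: prepend_eq)
  then have "v = u @ drop (length u) v" by (metis append_take_drop_id)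
  moreover have "drop (length u) v \<frown> z \<in> C" using assms by (simp add: prepend_eq)
  ultimately show thesis by (rule that)
qed

text \<open>If \<open>w\<close> is a loop with the data of \<open>u v\<close>, then \<open>M (u B) = c * M B\<close> for \<open>B \<subseteq> w [a]\<close>, where \<open>c\<close> is the factor
  of the loop \<open>u\<close> relative to \<open>u\<close>. The sets \<open>w [a]\<close> of this kind cover almost all of \<open>[a]\<close>, and \<open>u [a]\<close> has
  finite measure.\<close>

lemma cyl_finite: "emeasure M (cyl a) < \<infinity>"
proof -
  obtain u where u: "loop a u" and fin: "emeasure M (prepend A u (cyl a)) < \<infinity>"
    using exists_finite_loop by blast
  obtain c where c: "c > 0" "c \<noteq> \<infinity>"
    and scal: "\<And>B. B \<in> sets M \<Longrightarrow> B \<subseteq> cyl a \<Longrightarrow>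
      emeasure M (prepend A (u @ u) B) = c * emeasure M (prepend A u B)"
    using loop_scaling_relative[OF u fin u] by blast
  define W where "W = {w. loop a w \<and> (\<exists>v. loop a v \<and> same_data w (u @ v))}"
  define C where "C w = (if w \<in> W then prepend A w (cyl a) else {})" for w
  have C: "C w \<in> sets M" for w by (simp add: C_def)
  have Csub: "C w \<subseteq> cyl a" for w
    using loop_prepend_subset[of a w "cyl a"] by (auto simp: C_def W_def)
  have CU: "(\<Union>w. C w) \<in> sets M" using C by (intro sets.countable_UN'') auto
  \<comment> \<open>writing \<open>B = w B'\<close>, the word \<open>w\<close> is exchanged for \<open>u v\<close> and back\<close>
  have key: "emeasure M (prepend A u B) = c * emeasure M B"
    if B: "B \<in> sets M" "B \<subseteq> C w" for B w
  proof (cases "w \<in> W")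
    case False
    then have "B = {}" using B by (simp add: C_def)
    then show ?thesis by simp
  next
    case True
    then obtain v where w: "loop a w" and v: "loop a v" and wv: "same_data w (u @ v)"
      unfolding W_def by blast
    define B' where "B' = {z \<in> tms A. w \<frown> z \<in> B} \<inter> cyl a"
    have B': "B' \<in> sets M" "B' \<subseteq> cyl a"
      using vimage_conc_in_sets[OF B(1), of w] by (auto simp: B'_def)
    have B_eq: "B = prepend A w B'"
    proof
      show "prepend A w B' \<subseteq> B" by (auto simp: prepend_def B'_def)
      show "B \<subseteq> prepend A w B'"
      proof
        fix x assume x: "x \<in> B"
        then have "x \<in> prepend A w (cyl a)" using B(2) True by (auto simp: C_def)
        then show "x \<in> prepend A w B'" using x unfolding prepend_def B'_def
          by (auto simp: mem_cylinder_state)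
      qed
    qed
    have uv: "loop a (u @ v)" using u v by (rule word_path_appendI)
    have vB': "prepend A v B' \<in> sets M" "prepend A v B' \<subseteq> cyl a"
      using B' loop_prepend_subset[OF v B'(2)] by simp_all
    have "emeasure M (prepend A u B) = emeasure M (prepend A (u @ w) B')"
      by (simp add: B_eq prepend_append)
    also have "\<dots> = emeasure M (prepend A (u @ (u @ v)) B')"
      by (rule emeasure_prepend_same_data[OF B' word_path_appendI[OF u w] word_path_appendI[OF u uv]
          same_data_append[OF same_data_refl wv]])
    also have "\<dots> = emeasure M (prepend A (u @ u) (prepend A v B'))"
      by (simp add: prepend_append)
    also have "\<dots> = c * emeasure M (prepend A (u @ v) B')"
      by (subst scal[OF vB']) (simp only: prepend_append)
    also have "emeasure M (prepend A (u @ v) B') = emeasure M (prepend A w B')"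
      by (rule emeasure_prepend_same_data[OF B' uv w same_data_sym[OF wv]])
    finally show ?thesis by (simp add: B_eq)
  qed
  have ic: "inverse c * c = 1"
    using c ennreal_divide_self[of c] by (simp add: divide_ennreal_def mult.commute less_top)
  then have ictop: "inverse c \<noteq> \<infinity>" using c by (auto simp: ennreal_top_mult)
  define N where "N = scale_measure (inverse c) (word_measure u)"
  have N: "emeasure N B = inverse c * emeasure M (prepend A u B)" if "B \<in> sets M" for B
    using that by (simp add: N_def emeasure_word_measure)
  have "emeasure M (\<Union>w. C w) \<le> emeasure N (\<Union>w. C w)"
  proof (rule emeasure_UN_le_of_le_on_subsets)
    show "sets N = sets M" by (simp add: N_def)
    fix w B assume B: "B \<in> sets M" "B \<subseteq> C w"
    show "emeasure M B \<le> emeasure N B"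
      by (simp add: N[OF B(1)] key[OF B] mult.assoc[symmetric] ic)
  qed (rule C)
  also have "\<dots> \<le> inverse c * emeasure M (prepend A u (cyl a))"
    unfolding N[OF CU] using Csub
    by (intro mult_left_mono emeasure_mono prepend_mono) auto
  also have "\<dots> < \<infinity>"
  proof -
    have "inverse c < top" using ictop by (metis infinity_ennreal_def less_top)
    then show ?thesis
      unfolding infinity_ennreal_def ennreal_mult_less_top using fin by simp
  qed
  finally have fin': "emeasure M (\<Union>w. C w) < \<infinity>" .
  have "emeasure M (cyl a - (\<Union>w. C w)) = 0"
  proof (rule ccontr)
    assume pos: "emeasure M (cyl a - (\<Union>w. C w)) \<noteq> 0"
    have sets: "cyl a - (\<Union>w. C w) \<in> sets M" using CU by simp
    obtain v w B where vw: "same_data v w" "length u \<le> length v"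
      and B: "B \<in> sets M" "B \<subseteq> cyl a" "B \<noteq> {}"
      and in12: "\<forall>z\<in>B. v \<frown> z \<in> prepend A u (cyl a) \<and> w \<frown> z \<in> cyl a - (\<Union>w. C w)"
      by (rule transit[OF prepend_in_sets[OF cylinder_in_sets] sets prepend_cyl_positive[OF u] pos,
            where m="length u" and a=a]) blast
    obtain z where z: "z \<in> B" using B(3) by blast
    then have za: "z \<in> cyl a" using B(2) by blast
    have inz: "v \<frown> z \<in> prepend A u (cyl a)" "w \<frown> z \<in> cyl a" "w \<frown> z \<notin> C w"
      using in12 z by blast+
    obtain v1 where v1: "v = u @ v1" "v1 \<frown> z \<in> cyl a"
      using inz(1) vw(2) by (rule mem_prepend_conc_append)
    have "loop a w" "loop a v1" using za inz(2) v1(2) by (simp_all add: word_path_of_conc)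
    then have "w \<in> W" using vw(1) unfolding W_def v1(1) by (blast intro: same_data_sym)
    moreover have "w \<frown> z \<in> prepend A w (cyl a)"
      using inz(2) za by (auto simp: prepend_def mem_cylinder_state)
    ultimately show False using inz(3) by (simp add: C_def)
  qed
  then have null: "cyl a - (\<Union>w. C w) \<in> null_sets M" using CU by (intro null_setsI) auto
  have "cyl a = (\<Union>w. C w) \<union> (cyl a - (\<Union>w. C w))" using Csub by blast
  then have "emeasure M (cyl a) = emeasure M (\<Union>w. C w)"
    using emeasure_Un_null_set[OF CU null] by simp
  then show ?thesis using fin' by simp
qed

text \<open>The factor by which prepending the word \<open>w\<close> scales the measure on the partition set of
  \<open>a\<close>.\<close>

definition scal :: "'s \<Rightarrow> 's list \<Rightarrow> real" where
  "scal a w = measure M (prepend A w (cyl a)) / measure M (cyl a)"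

lemma loop_scaling:
  assumes e: "loop a e"
  shows "scal a e > 0"
    and "B \<in> sets M \<Longrightarrow> B \<subseteq> cyl a \<Longrightarrow> emeasure M (prepend A e B) = ennreal (scal a e) * emeasure M B"
proof -
  have Nil: "prepend A [] B = B" if "B \<subseteq> cyl a" for B
    using that by (intro prepend_Nil) (auto simp: mem_cylinder_state)
  obtain c where c: "c > 0" "c \<noteq> \<infinity>" and *: "\<And>B. B \<in> sets M \<Longrightarrow> B \<subseteq> cyl a \<Longrightarrow>
      emeasure M (prepend A ([] @ e) B) = c * emeasure M (prepend A [] B)"
    using loop_scaling_relative[of a "[]" e] e cyl_finite[of a] Nil[of "cyl a"] by auto
  then obtain r where r: "c = ennreal r" "r > 0"
    by (cases c) (auto simp: less_eq_real_def)
  have **: "emeasure M (prepend A e B) = ennreal r * emeasure M B" if "B \<in> sets M" "B \<subseteq> cyl a" for B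
    using *[OF that] Nil[OF that(2)] r by simp
  have pos: "measure M (cyl a) > 0"
    using cyl_finite[of a] cyl_positive[of a] by (simp add: measure_def enn2real_positive_iff)
  have "measure M (prepend A e (cyl a)) = r * measure M (cyl a)"
    using **[of "cyl a"] r by (simp add: measure_def enn2real_mult)
  then have "scal a e = r" using pos by (simp add: scal_def)
  then show "scal a e > 0"
    and "B \<in> sets M \<Longrightarrow> B \<subseteq> cyl a \<Longrightarrow> emeasure M (prepend A e B) = ennreal (scal a e) * emeasure M B"
    using r ** by simp_all
qed

end

section \<open>The homomorphism\<close>

text \<open>The consequences of mixing and of aperiodicity that are needed to determine the factors of loops:
  the lengths of loops have no common divisor, and the differences of \<open>\<phi>\<close>-sums of loops of equal
  lengths, at arbitrary base points, generate the group.\<close>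

locale aperiodic_tail_ergodic_measure = tail_ergodic_measure A M \<phi> f
  for A :: "'s::countable \<Rightarrow> 's \<Rightarrow> nat" and M :: "(nat \<Rightarrow> 's) measure"
    and \<phi> :: "(nat \<Rightarrow> 's) \<Rightarrow> 'g::ab_group_add" and f :: "'s \<Rightarrow> 'g" +
  assumes consecutive_loops: "\<exists>u v. loop a u \<and> loop a v \<and> length u = Suc (length v)"
    and generated: "group_closure {fsum p - fsum q |p q.
      length p = length q \<and> (\<exists>b. loop b p) \<and> (\<exists>b. loop b q)} = UNIV"
begin

lemma cyl_measure: "emeasure M (cyl a) = ennreal (measure M (cyl a))" "measure M (cyl a) > 0"
proof -
  show "emeasure M (cyl a) = ennreal (measure M (cyl a))"
    using cyl_finite[of a] by (intro emeasure_eq_ennreal_measure) auto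
  then show "measure M (cyl a) > 0" using cyl_positive[of a]
    by (metis ennreal_0 less_numeral_extra(3) measure_nonneg order_le_less)
qed

lemma scal_eqI:
  assumes "emeasure M (prepend A w (cyl a)) = ennreal r * emeasure M (cyl a)" "r \<ge> 0"
  shows "scal a w = r"
proof -
  have "measure M (prepend A w (cyl a)) = r * measure M (cyl a)"
    using assms by (simp add: measure_def enn2real_mult)
  then show ?thesis using cyl_measure(2)[of a] by (simp add: scal_def)
qed

lemma scal_append:
  assumes "loop a u" "loop a v" shows "scal a (u @ v) = scal a u * scal a v"
proof (rule scal_eqI)
  have "emeasure M (prepend A u (prepend A v (cyl a))) = ennreal (scal a u) * (ennreal (scal a v) * emeasure M (cyl a))"
    using loop_scaling(2)[OF assms(1)] loop_scaling(2)[OF assms(2), of "cyl a"]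
      loop_prepend_subset[OF assms(2), of "cyl a"] by simp
  then show "emeasure M (prepend A (u @ v) (cyl a)) = ennreal (scal a u * scal a v) * emeasure M (cyl a)"
    using loop_scaling(1)[OF assms(1)] loop_scaling(1)[OF assms(2)]
    by (simp add: prepend_append ennreal_mult mult.assoc)
  show "scal a u * scal a v \<ge> 0"
    using loop_scaling(1)[OF assms(1)] loop_scaling(1)[OF assms(2)] by simp
qed

lemma ln_scal_append:
  "loop a u \<Longrightarrow> loop a v \<Longrightarrow> ln (scal a (u @ v)) = ln (scal a u) + ln (scal a v)"
  using loop_scaling(1)[of a u] loop_scaling(1)[of a v] by (simp add: scal_append ln_mult)

lemma scal_same_data:
  assumes "loop a u" "loop a v" "same_data u v" shows "scal a u = scal a v"
  using emeasure_prepend_same_data[OF cylinder_in_sets order_refl assms]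
  by (simp add: scal_def measure_def)

text \<open>The graph of the homomorphism \<open>h\<close>: for loops \<open>u\<close>, \<open>v\<close> at \<open>a\<close> of equal length, \<open>h\<close> maps the difference of
  the \<open>\<phi>\<close>-sums to the logarithm of \<open>scal a v / scal a u\<close>.\<close>

definition displacement :: "'s \<Rightarrow> 'g \<Rightarrow> real \<Rightarrow> bool" where
  "displacement a g x \<longleftrightarrow> (\<exists>u v. loop a u \<and> loop a v \<and> length u = length v \<and>
     g = fsum u - fsum v \<and> x = ln (scal a v) - ln (scal a u))"

lemma displacement_unique:
  assumes "displacement a g x" "displacement a g y" shows "x = y"
proof -
  obtain u v where u: "loop a u" "loop a v" "length u = length v" "g = fsum u - fsum v"
    "x = ln (scal a v) - ln (scal a u)" using assms(1) unfolding displacement_def by blast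
  obtain p q where p: "loop a p" "loop a q" "length p = length q" "g = fsum p - fsum q"
    "y = ln (scal a q) - ln (scal a p)" using assms(2) unfolding displacement_def by blast
  have "fsum u - fsum v = fsum p - fsum q" using u(4) p(4) by simp
  then have "fsum u + fsum q = fsum v + fsum p" by (simp add: algebra_simps)
  then have "same_data (u @ q) (v @ p)" using u(3) p(3) by (simp add: same_data_def)
  then have "scal a (u @ q) = scal a (v @ p)"
    using u p by (intro scal_same_data word_path_appendI[of A a _ a])
  then have "ln (scal a u) + ln (scal a q) = ln (scal a v) + ln (scal a p)"
    using u p by (simp flip: ln_scal_append)
  then show ?thesis using u(5) p(5) by simp
qed

lemma displacement_add:
  assumes "displacement a g x" "displacement a k y" shows "displacement a (g + k) (x + y)"
proof -
  obtain u v where u: "loop a u" "loop a v" "length u = length v" "g = fsum u - fsum v"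
    "x = ln (scal a v) - ln (scal a u)" using assms(1) unfolding displacement_def by blast
  obtain p q where p: "loop a p" "loop a q" "length p = length q" "k = fsum p - fsum q"
    "y = ln (scal a q) - ln (scal a p)" using assms(2) unfolding displacement_def by blast
  show ?thesis unfolding displacement_def
    using u p by (intro exI[of _ "u @ p"] exI[of _ "v @ q"])
      (simp add: ln_scal_append word_path_appendI[of A a _ a])
qed

lemma displacement_minus:
  assumes "displacement a g x" shows "displacement a (- g) (- x)"
proof -
  obtain u v where u: "loop a u" "loop a v" "length u = length v" "g = fsum u - fsum v"
    "x = ln (scal a v) - ln (scal a u)" using assms(1) unfolding displacement_def by blast
  show ?thesis unfolding displacement_def
    using u by (intro exI[of _ v] exI[of _ u]) simp
qed

lemma displacement_exists: "\<exists>x. displacement a g x"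
proof -
  have "g \<in> group_closure {fsum p - fsum q |p q.
      length p = length q \<and> (\<exists>b. loop b p) \<and> (\<exists>b. loop b q)}"
    by (simp add: generated)
  then show ?thesis
  proof (induction rule: group_closure.induct)
    case (base g)
    have "displacement a 0 0"
      unfolding displacement_def by (intro exI[of _ "[]"]) simp
    moreover have "\<exists>x. displacement a (fsum p - fsum q) x"
      if len: "length p = length q" and p: "loop b p" and q: "loop b' q" for p q b b'
    proof -
      obtain r r' s s' where r: "word_path A a r b" "word_path A b r' a"
        and s: "word_path A a s b'" "word_path A b' s' a"
        using connected[of a b] connected[of b a] connected[of a b'] connected[of b' a] by blast
      \<comment> \<open>\<open>p\<close> and \<open>q\<close> are made into loops at \<open>a\<close> by detours of the same total length and \<open>\<phi>\<close>-sum\<close>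
      let ?u = "r @ p @ r' @ s @ s'" and ?v = "r @ r' @ s @ q @ s'"
      have "loop a ?u"
        by (rule word_path_appendI[OF r(1) word_path_appendI[OF p word_path_appendI[OF r(2)
              word_path_appendI[OF s]]]])
      moreover have "loop a ?v"
        by (rule word_path_appendI[OF r(1) word_path_appendI[OF r(2) word_path_appendI[OF s(1)
              word_path_appendI[OF q s(2)]]]])
      moreover have "fsum p - fsum q = fsum ?u - fsum ?v" by simp
      moreover have "length ?u = length ?v" using len by simp
      ultimately show ?thesis unfolding displacement_def by blast
    qed
    ultimately show ?case using base by (auto simp del: word_path.simps)
  next
    case (diff g k)
    then obtain x y where "displacement a g x" "displacement a k y" by blast
    then have "displacement a (g + - k) (x + - y)"
      by (intro displacement_add displacement_minus)
    then show ?case by auto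
  qed
qed

lemma loop_concat_replicate: "loop a u \<Longrightarrow> loop a (concat (replicate n u))"
  by (induction n) (auto intro: word_path_appendI)

lemma ln_scal_concat_replicate:
  "loop a u \<Longrightarrow> ln (scal a (concat (replicate n u))) = real n * ln (scal a u)"
proof (induction n)
  case 0
  have "scal a [] = 1" by (rule scal_eqI) (simp_all add: prepend_Nil cylinder_def)
  then show ?case by simp
next
  case (Suc n)
  then show ?case by (simp add: ln_scal_append loop_concat_replicate algebra_simps)
qed

text \<open>The homomorphism \<open>h\<close> accounts for loops of equal length. The remaining constant \<open>\<kappa>\<close> is read off
  from two loops \<open>u0\<close>, \<open>v0\<close> of consecutive lengths: for a loop \<open>u\<close> of length \<open>n\<close>, the loops \<open>u v0 ... v0\<close>
  and \<open>u0 ... u0\<close> with \<open>n\<close> repetitions have equal length.\<close>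

lemma scal_homomorphism:
  "\<exists>(h :: 'g \<Rightarrow> real) \<kappa>. Modules.additive h \<and>
     (\<forall>u. loop a u \<longrightarrow> ln (scal a u) = real (length u) * \<kappa> - h (fsum u))"
proof -
  obtain h where h: "\<And>g. displacement a g (h g)" using displacement_exists by metis
  have add: "h (g + k) = h g + h k" for g k
    using displacement_unique[OF h displacement_add[OF h h]] .
  interpret h: Modules.additive h by standard (rule add)
  obtain u0 v0 where u0: "loop a u0" "loop a v0" "length u0 = Suc (length v0)"
    using consecutive_loops by blast
  define d where "d = fsum u0 - fsum v0"
  define \<kappa> where "\<kappa> = ln (scal a u0) - ln (scal a v0) + h d"
  have "ln (scal a u) = real (length u) * \<kappa> - h (fsum u)" if u: "loop a u" for u
  proof -
    define n where "n = length u"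
    let ?V = "\<lambda>n. concat (replicate n v0)" and ?U = "\<lambda>n. concat (replicate n u0)"
    have len: "length (?U m) = m + length (?V m)" for m
      by (induction m) (simp_all add: u0(3))
    have hd: "h (fsum (?U m) - fsum (?V m)) = real m * h d" for m
    proof (induction m)
      case 0 then show ?case by (simp add: h.zero)
    next
      case (Suc m)
      have "fsum (?U (Suc m)) - fsum (?V (Suc m)) = d + (fsum (?U m) - fsum (?V m))"
        by (simp add: d_def algebra_simps)
      then have "h (fsum (?U (Suc m)) - fsum (?V (Suc m))) = h d + real m * h d"
        by (simp only: add Suc)
      then show ?case by (simp add: algebra_simps)
    qed
    have "displacement a (fsum (u @ ?V n) - fsum (?U n)) (ln (scal a (?U n)) - ln (scal a (u @ ?V n)))"
      unfolding displacement_def using u u0 len[of n]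
      by (intro exI[of _ "u @ ?V n"] exI[of _ "?U n"])
        (simp add: n_def loop_concat_replicate word_path_appendI[of A a _ a])
    then have "h (fsum (u @ ?V n) - fsum (?U n)) = ln (scal a (?U n)) - ln (scal a (u @ ?V n))"
      using displacement_unique[OF h] by blast
    moreover have "fsum (u @ ?V n) - fsum (?U n) = fsum u - (fsum (?U n) - fsum (?V n))"
      by simp
    ultimately have "h (fsum u) - real n * h d = ln (scal a (?U n)) - ln (scal a (u @ ?V n))"
      by (simp only: h.diff[of "fsum u"] hd)
    then have "h (fsum u) - real n * h d = real n * ln (scal a u0) - (ln (scal a u) + real n * ln (scal a v0))"
      using u u0 by (simp add: ln_scal_append loop_concat_replicate ln_scal_concat_replicate)
    then show ?thesis by (simp add: \<kappa>_def n_def algebra_simps)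
  qed
  then show ?thesis using h.additive_axioms by blast
qed

end

section \<open>Prepending one letter\<close>

context aperiodic_tail_ergodic_measure
begin

text \<open>Transit from \<open>[a]\<close> to \<open>[t]\<close> links the measure at \<open>t\<close> to the measure at \<open>a\<close>.\<close>

lemma scal_transfer:
  "\<exists>x w B. loop a x \<and> word_path A t w a \<and> same_data x w \<and>
     B \<in> sets M \<and> B \<subseteq> cyl a \<and> emeasure M B \<noteq> 0"
proof -
  have pos: "emeasure M (cyl a) \<noteq> 0" "emeasure M (cyl t) \<noteq> 0"
    using cyl_positive[of a] cyl_positive[of t] by simp_all
  obtain v w B where vw: "same_data v w" and B: "B \<in> sets M" "B \<subseteq> cyl a" "B \<noteq> {}"
    and in12: "\<forall>z\<in>B. v \<frown> z \<in> cyl a \<and> w \<frown> z \<in> cyl t"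
    and Bpos: "emeasure M (prepend A w B) \<noteq> 0"
    by (rule transit[OF cylinder_in_sets cylinder_in_sets pos, where m=0 and a=a]) blast
  obtain z where z: "z \<in> B" using B(3) by blast
  have path: "loop a v" "word_path A t w a"
    using z B(2) in12 word_path_of_conc[of z a] by blast+
  have "emeasure M (prepend A w B) = emeasure M (prepend A v B)"
    by (rule emeasure_prepend_same_data[OF B(1,2) path(2,1) same_data_sym[OF vw]])
  also have "\<dots> = ennreal (scal a v) * emeasure M B"
    by (rule loop_scaling(2)[OF path(1) B(1,2)])
  finally have "emeasure M B \<noteq> 0" using Bpos by auto
  then show ?thesis using vw B path by blast
qed

text \<open>The factor of a loop does not depend on its base point. With \<open>x\<close>, \<open>w\<close> from the preceding lemma, the
  words \<open>v w\<close> and \<open>w l\<close> have the same data, and \<open>w\<close> may be exchanged for the loop \<open>x\<close> at \<open>a\<close>.\<close>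

lemma scal_eq_of_same_data:
  assumes v: "loop t v" and l: "loop a l" and vl: "same_data v l"
  shows "scal t v = scal a l"
proof -
  obtain x w B where x: "loop a x" and w: "word_path A t w a" and xw: "same_data x w"
    and B: "B \<in> sets M" "B \<subseteq> cyl a" "emeasure M B \<noteq> 0"
    using scal_transfer[of a t] by blast
  have lB: "prepend A l B \<in> sets M" "prepend A l B \<subseteq> cyl a"
    using B loop_prepend_subset[OF l B(2)] by simp_all
  have wB: "prepend A w B \<in> sets M" "prepend A w B \<subseteq> cyl t"
    using B prepend_path_subset(2)[OF B(2) w] by simp_all
  have vl': "same_data (v @ w) (w @ l)"
    using vl by (simp add: same_data_def add.commute)
  have "ennreal (scal t v) * (ennreal (scal a x) * emeasure M B)
      = ennreal (scal t v) * emeasure M (prepend A x B)"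
    by (simp add: loop_scaling(2)[OF x B(1,2)])
  also have "\<dots> = ennreal (scal t v) * emeasure M (prepend A w B)"
    by (simp add: emeasure_prepend_same_data[OF B(1,2) x w xw])
  also have "\<dots> = emeasure M (prepend A (v @ w) B)"
    by (simp add: loop_scaling(2)[OF v wB] prepend_append)
  also have "\<dots> = emeasure M (prepend A (w @ l) B)"
    by (rule emeasure_prepend_same_data[OF B(1,2) word_path_appendI[OF v w] word_path_appendI[OF w l] vl'])
  also have "\<dots> = emeasure M (prepend A w (prepend A l B))"
    by (simp add: prepend_append)
  also have "\<dots> = emeasure M (prepend A x (prepend A l B))"
    by (rule emeasure_prepend_same_data[OF lB w x same_data_sym[OF xw]])
  also have "\<dots> = ennreal (scal a x) * (ennreal (scal a l) * emeasure M B)"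
    by (simp add: loop_scaling(2)[OF x lB] loop_scaling(2)[OF l B(1,2)])
  finally have *: "ennreal (scal t v) * (ennreal (scal a x) * emeasure M B)
      = ennreal (scal a x) * (ennreal (scal a l) * emeasure M B)" .
  have "emeasure M B \<le> emeasure M (cyl a)" using B by (intro emeasure_mono) auto
  then have "emeasure M B < \<infinity>" using cyl_finite[of a] by (rule le_less_trans)
  then obtain b where b: "emeasure M B = ennreal b" "b > 0"
    using B(3) by (cases "emeasure M B") (auto simp: less_eq_real_def)
  have pos: "scal t v > 0" "scal a x > 0" "scal a l > 0"
    using loop_scaling(1) v x l by blast+
  have "ennreal (scal t v * (scal a x * b)) = ennreal (scal a x * (scal a l * b))"
    using * pos b by (simp add: ennreal_mult)
  then have "scal t v * (scal a x * b) = scal a x * (scal a l * b)"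
    using pos b by (subst (asm) ennreal_inj) auto
  then show ?thesis using pos b by simp
qed

text \<open>For a single letter \<open>s\<close> followed by \<open>t\<close>, transit between \<open>s [t]\<close> and \<open>[t]\<close> yields loops \<open>l\<close>, \<open>l'\<close> at \<open>t\<close> such
  that \<open>s l\<close> and \<open>l'\<close> have the same data. Choose a path \<open>v\<close> from \<open>t\<close> to \<open>s\<close>. The measure of \<open>s l v s B\<close> can
  be computed in two ways, using the loop \<open>s l v\<close> at \<open>s\<close>, or using the loops \<open>l'\<close> and \<open>v s\<close> at \<open>t\<close>.\<close>

lemma letter_scaling:
  "\<exists>(h :: 'g \<Rightarrow> real) \<kappa>. Modules.additive h \<and>
     (\<forall>s B. B \<in> sets M \<longrightarrow> (\<forall>x\<in>B. A s (x 0) = 1) \<longrightarrow>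
       emeasure M (prepend A [s] B) = ennreal (exp (\<kappa> - h (f s))) * emeasure M B)"
proof -
  fix a :: 's
  obtain h :: "'g \<Rightarrow> real" and \<kappa> where h: "Modules.additive h"
    and scal_a: "\<And>u. loop a u \<Longrightarrow> ln (scal a u) = real (length u) * \<kappa> - h (fsum u)"
    using scal_homomorphism[of a] by blast
  interpret h: Modules.additive h by (rule h)
  \<comment> \<open>the claimed factor of an arbitrary word\<close>
  define X where "X w = exp (real (length w) * \<kappa> - h (fsum w))" for w
  have X_append: "X (v @ w) = X v * X w" for v w
    by (simp add: X_def h.add exp_add[symmetric] algebra_simps)
  have X_pos: "X w > 0" for w by (simp add: X_def)
  have X_same: "X v = X w" if "same_data v w" for v w
    using that by (simp add: X_def same_data_def)
  have scal_X: "scal t v = X v" if v: "loop t v" for t v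
  proof -
    have X_a: "scal a u = X u" if "loop a u" for u
      unfolding X_def scal_a[OF that, symmetric] using loop_scaling(1)[OF that] by simp
    obtain p p' where p: "word_path A a p t" "word_path A t p' a"
      using connected[of a t] connected[of t a] by blast
    have tp: "loop t (p' @ p)" by (rule word_path_appendI[OF p(2,1)])
    have "scal t (p' @ p) = scal a (p @ p')"
      by (rule scal_eq_of_same_data[OF tp word_path_appendI[OF p]]) (simp add: same_data_def)
    moreover have "scal t (v @ (p' @ p)) = scal a (p @ v @ p')"
      by (rule scal_eq_of_same_data[OF word_path_appendI[OF v tp]
            word_path_appendI[OF p(1) word_path_appendI[OF v p(2)]]]) (simp add: same_data_def)
    moreover have "scal a (p @ p') = X (p @ p')" "scal a (p @ v @ p') = X (p @ v @ p')"
      by (rule X_a, rule word_path_appendI[OF p], rule X_a,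
          rule word_path_appendI[OF p(1) word_path_appendI[OF v p(2)]])
    ultimately have "scal t v * (X p * X p') = X p * X v * X p'"
      by (simp add: scal_append[OF v tp] X_append)
    then show ?thesis using X_pos[of p] X_pos[of p'] by simp
  qed
  have loop_X: "emeasure M (prepend A v B) = ennreal (X v) * emeasure M B"
    if "loop t v" "B \<in> sets M" "B \<subseteq> cyl t" for t v B
    using loop_scaling(2)[OF that] scal_X[OF that(1)] by simp
  have cyl_case: "emeasure M (prepend A [s] B) = ennreal (X [s]) * emeasure M B"
    if st: "A s t = 1" and B: "B \<in> sets M" "B \<subseteq> cyl t" for s t B
  proof -
    have s: "word_path A s [s] t" using st by simp
    have pos: "emeasure M (prepend A [s] (cyl t)) \<noteq> 0" "emeasure M (cyl t) \<noteq> 0"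
      using prepend_cyl_positive[OF s] cyl_positive[of t] by simp_all
    have sets: "prepend A [s] (cyl t) \<in> sets M" by simp
    obtain y l' B' where yl: "same_data y l'" "1 \<le> length y" and B': "B' \<in> sets M" "B' \<subseteq> cyl t" "B' \<noteq> {}"
      and in12: "\<forall>z\<in>B'. y \<frown> z \<in> prepend A [s] (cyl t) \<and> l' \<frown> z \<in> cyl t"
      by (rule transit[OF sets cylinder_in_sets pos, where m=1 and a=t]) blast
    obtain z where "z \<in> B'" using B'(3) by blast
    then have z: "z \<in> cyl t" "y \<frown> z \<in> prepend A [s] (cyl t)" "l' \<frown> z \<in> cyl t"
      using B'(2) in12 by blast+
    have "length [s] \<le> length y" using yl(2) by simp
    from mem_prepend_conc_append[OF z(2) this]
    obtain l where l: "y = [s] @ l" "l \<frown> z \<in> cyl t" .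
    have loops: "loop t l" "loop t l'" using word_path_of_conc[OF z(1)] l(2) z(3) by blast+
    obtain v where v: "word_path A t v s" using connected[of t s] by blast
    define C where "C = prepend A (v @ [s]) B"
    have vs: "loop t (v @ [s])" by (rule word_path_appendI[OF v s])
    have C: "C \<in> sets M" "C \<subseteq> cyl t"
      using B loop_prepend_subset[OF vs B(2)] by (simp_all add: C_def)
    have sB: "prepend A [s] B \<in> sets M" "prepend A [s] B \<subseteq> cyl s"
      using B prepend_path_subset(2)[OF B(2) s] by simp_all
    have slv: "loop s ([s] @ (l @ v))"
      by (rule word_path_appendI[OF s word_path_appendI[OF loops(1) v]])
    have "ennreal (X ([s] @ (l @ v))) * emeasure M (prepend A [s] B)
        = emeasure M (prepend A ([s] @ (l @ v)) (prepend A [s] B))"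
      by (rule loop_X[OF slv sB, symmetric])
    also have "\<dots> = emeasure M (prepend A ([s] @ l) C)"
      by (simp only: C_def prepend_append)
    also have "\<dots> = emeasure M (prepend A l' C)"
      by (rule emeasure_prepend_same_data[OF C word_path_appendI[OF s loops(1)] loops(2)
            yl(1)[unfolded l(1)]])
    also have "\<dots> = ennreal (X l') * (ennreal (X (v @ [s])) * emeasure M B)"
      by (simp add: loop_X[OF loops(2) C] loop_X[OF vs B, folded C_def])
    also have "X l' = X ([s] @ l)" by (rule X_same[OF same_data_sym[OF yl(1)[unfolded l(1)]]])
    finally have "ennreal (X [s] * (X l * X v)) * emeasure M (prepend A [s] B)
        = ennreal (X [s] * (X l * X v)) * (ennreal (X [s]) * emeasure M B)"
      using X_pos by (simp only: X_append ennreal_mult[OF less_imp_le less_imp_le] mult.assoc mult.left_commute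
          mult_pos_pos)
    then show ?thesis
      using X_pos[of "[s]"] X_pos[of l] X_pos[of v]
      by (subst (asm) ennreal_mult_cancel_left) auto
  qed
  have "emeasure M (prepend A [s] B) = ennreal (exp (\<kappa> - h (f s))) * emeasure M B"
    if B: "B \<in> sets M" "\<forall>x\<in>B. A s (x 0) = 1" for s B
  proof -
    have sets: "B \<inter> cyl t \<in> sets M" for t using B(1) by simp
    have B_UN: "B = (\<Union>t. B \<inter> cyl t)"
      using sets_subset_tms[OF B(1)] by (auto simp: mem_cylinder_state)
    have dB: "disjoint_family (\<lambda>t. B \<inter> cyl t)"
      by (auto simp: disjoint_family_on_def mem_cylinder_state)
    have dP: "disjoint_family (\<lambda>t. prepend A [s] (B \<inter> cyl t))"
      by (auto simp: disjoint_family_on_def mem_cylinder_state prepend_eq)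
    have "prepend A [s] B = (\<Union>t. prepend A [s] (B \<inter> cyl t))"
      using arg_cong[OF B_UN, of "prepend A [s]"] by (simp only: prepend_UN)
    then have "emeasure M (prepend A [s] B) = (\<integral>\<^sup>+t. emeasure M (prepend A [s] (B \<inter> cyl t)) \<partial>count_space UNIV)"
      using sets dP by (simp add: emeasure_UN_countable)
    also have "\<dots> = (\<integral>\<^sup>+t. ennreal (X [s]) * emeasure M (B \<inter> cyl t) \<partial>count_space UNIV)"
    proof (rule nn_integral_cong)
      fix t
      show "emeasure M (prepend A [s] (B \<inter> cyl t)) = ennreal (X [s]) * emeasure M (B \<inter> cyl t)"
      proof (cases "A s t = 1")
        case True
        then show ?thesis by (rule cyl_case) (use sets in auto)
      next
        case False
        then have "B \<inter> cyl t = {}" using B(2) by (auto simp: mem_cylinder_state)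
        then show ?thesis by simp
      qed
    qed
    also have "\<dots> = ennreal (X [s]) * (\<integral>\<^sup>+t. emeasure M (B \<inter> cyl t) \<partial>count_space UNIV)"
      by (rule nn_integral_cmult) simp
    also have "(\<integral>\<^sup>+t. emeasure M (B \<inter> cyl t) \<partial>count_space UNIV) = emeasure M B"
      using emeasure_UN_countable[OF sets _ dB] B_UN by simp
    finally show ?thesis by (simp add: X_def)
  qed
  then show ?thesis using h by blast
qed

end

section \<open>The Markov property and the derivative\<close>

lemma has_sum_measure_UN:
  fixes C :: "'i::countable \<Rightarrow> 'a set"
  assumes C: "\<And>i. C i \<in> sets M" "disjoint_family C" and fin: "emeasure M (\<Union>i. C i) \<noteq> \<infinity>"
  shows "((\<lambda>i. measure M (C i)) has_sum measure M (\<Union>i. C i)) UNIV"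
proof -
  have CU: "(\<Union>i. C i) \<in> sets M" using C(1) by (intro sets.countable_UN'') auto
  have fin': "emeasure M (C i) = ennreal (measure M (C i))" for i
  proof -
    have "emeasure M (C i) \<le> emeasure M (\<Union>i. C i)" using CU by (intro emeasure_mono) auto
    then show ?thesis using fin by (intro emeasure_eq_ennreal_measure) (auto simp: top_unique)
  qed
  have nn: "(\<integral>\<^sup>+i. ennreal (measure M (C i)) \<partial>count_space UNIV) = ennreal (measure M (\<Union>i. C i))"
  proof -
    have "emeasure M (\<Union>i. C i) = (\<integral>\<^sup>+i. emeasure M (C i) \<partial>count_space UNIV)"
      using C by (intro emeasure_UN_countable) auto
    moreover have "emeasure M (\<Union>i. C i) = ennreal (measure M (\<Union>i. C i))"
      using fin by (intro emeasure_eq_ennreal_measure) simp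
    ultimately show ?thesis unfolding fin' by (simp only:)
  qed
  have int: "integrable (count_space UNIV) (\<lambda>i. measure M (C i))"
    by (rule integrableI_nn_integral_finite[OF _ _ nn]) auto
  have "integral\<^sup>L (count_space UNIV) (\<lambda>i. measure M (C i)) = measure M (\<Union>i. C i)"
    by (subst integral_eq_nn_integral) (simp_all add: nn)
  moreover have abs: "Infinite_Set_Sum.abs_summable_on (\<lambda>i. measure M (C i)) UNIV"
    using int by (simp add: Infinite_Set_Sum.abs_summable_on_def)
  ultimately have "infsum (\<lambda>i. measure M (C i)) UNIV = measure M (\<Union>i. C i)"
    by (simp add: infsetsum_infsum[symmetric] infsetsum_def)
  moreover have "(\<lambda>i. measure M (C i)) summable_on UNIV"
    using abs abs_summable_equivalent abs_summable_summable by blast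
  ultimately show ?thesis by (metis has_sum_infsum)
qed

context aperiodic_tail_ergodic_measure
begin

lemma prepend_letter_cylinder: "prepend A [s] (cylinder A w) = cylinder A (s # w)"
proof -
  have "prefix (Suc n) x = x 0 # prefix n (suffix 1 x)" for n and x :: "nat \<Rightarrow> 's"
    using prefix_add[where n=1 and k=n and u=x] by (simp del: subseq_to_Suc subsequence_shift)
  then show ?thesis
    by (auto simp: prepend_eq mem_cylinder_iff tms_suffix simp del: subseq_to_Suc)
qed

lemma cylinder_recursion:
  assumes scal: "\<And>s B. B \<in> sets M \<Longrightarrow> \<forall>x\<in>B. A s (x 0) = 1 \<Longrightarrow>
      emeasure M (prepend A [s] B) = ennreal (k s) * emeasure M B"
  shows "emeasure M (cylinder A (s # t # w)) = (if A s t = 1 then ennreal (k s) else 0) * emeasure M (cylinder A (t # w))"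
proof (cases "A s t = 1")
  case True
  have "x 0 = t" if "x \<in> cylinder A (t # w)" for x using that by (force simp: cylinder_def)
  then have "\<forall>x\<in>cylinder A (t # w). A s (x 0) = 1" using True by metis
  from scal[OF cylinder_in_sets this] show ?thesis
    using True by (simp add: prepend_letter_cylinder)
next
  case False
  have "A (x 0) (x (Suc 0)) = 1 \<and> x 0 = s \<and> x (Suc 0) = t" if "x \<in> cylinder A (s # t # w)" for x
  proof -
    have "x \<in> tms A" and *: "\<And>i. i < length (s # t # w) \<Longrightarrow> x i = (s # t # w) ! i"
      using that unfolding cylinder_def by blast+
    from \<open>x \<in> tms A\<close> have "A (x 0) (x (Suc 0)) = 1" by (simp add: tms_def)
    then show ?thesis using *[of 0] *[of 1] by simp
  qed
  then have "cylinder A (s # t # w) = {}" using False by blast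
  then show ?thesis using False by simp
qed

lemma markov: "markov_measure A M"
proof -
  obtain h :: "'g \<Rightarrow> real" and \<kappa> where scal: "\<And>s B. B \<in> sets M \<Longrightarrow> \<forall>x\<in>B. A s (x 0) = 1 \<Longrightarrow>
       emeasure M (prepend A [s] B) = ennreal (exp (\<kappa> - h (f s))) * emeasure M B"
    using letter_scaling by blast
  define K where "K s t = (if A s t = 1 then exp (\<kappa> - h (f s)) else 0)" for s t
  have K0: "K s t \<ge> 0" for s t by (simp add: K_def)
  have rec: "emeasure M (cylinder A (s # t # w)) = ennreal (K s t) * emeasure M (cylinder A (t # w))" for s t w
    using cylinder_recursion[OF scal] by (simp add: K_def)
  define p where "p s t = measure M (cylinder A [s, t]) / measure M (cyl s)" for s t
  have p: "ennreal (measure M (cyl s)) * ennreal (p s t) = emeasure M (cylinder A [s, t])" for s t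
  proof -
    have "emeasure M (cylinder A [s, t]) = ennreal (K s t * measure M (cyl t))"
      using rec[of s t "[]"] K0 by (simp add: cyl_measure(1)[of t] ennreal_mult)
    then have "emeasure M (cylinder A [s, t]) = ennreal (measure M (cylinder A [s, t]))"
      by (intro emeasure_eq_ennreal_measure) simp
    then show ?thesis using cyl_measure(2)[of s]
      by (simp add: p_def ennreal_mult[symmetric])
  qed
  have p0: "p s t \<ge> 0" for s t by (simp add: p_def)
  have "stochastic_matrix p"
    unfolding stochastic_matrix_def
  proof (intro conjI allI p0)
    fix s
    have U: "(\<Union>t. cylinder A [s, t]) = cyl s"
      by (auto simp: cylinder_def less_Suc_eq)
    have "((\<lambda>t. measure M (cylinder A [s, t])) has_sum measure M (cyl s)) UNIV"
    proof -
      have "x 1 = t" if "x \<in> cylinder A [s, t]" for x t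
        using that by (simp add: cylinder_def)
      then have "disjoint_family (\<lambda>t. cylinder A [s, t])"
        unfolding disjoint_family_on_def by blast
      from has_sum_measure_UN[OF cylinder_in_sets this] show ?thesis
        using cyl_finite[of s] unfolding U by simp
    qed
    from has_sum_cmult_left[OF this, of "1 / measure M (cyl s)"]
    show "(p s has_sum 1) UNIV"
      using cyl_measure(2)[of s] by (simp add: p_def[abs_def])
  qed
  moreover have "emeasure M (cylinder A w) = emeasure M (cyl (hd w)) *
      ennreal (\<Prod>i<length w - 1. p (w ! i) (w ! Suc i))" if "w \<noteq> []" for w
    using that
  proof (induction w rule: induct_list012)
    case (3 s t w)
    have "emeasure M (cylinder A (s # t # w)) = ennreal (K s t) * (emeasure M (cyl t) * 
        ennreal (\<Prod>i<length w. p ((t # w) ! i) (w ! i)))"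
      using 3 by (simp add: rec)
    also have "\<dots> = emeasure M (cylinder A [s, t]) * ennreal (\<Prod>i<length w. p ((t # w) ! i) (w ! i))"
      by (simp add: rec mult.assoc)
    also have "\<dots> = emeasure M (cyl s) * (ennreal (p s t) * ennreal (\<Prod>i<length w. p ((t # w) ! i) (w ! i)))"
      by (simp only: p[symmetric] cyl_measure(1)[of s] mult.assoc)
    also have "ennreal (p s t) * ennreal (\<Prod>i<length w. p ((t # w) ! i) (w ! i)) =
        ennreal (\<Prod>i<Suc (length w). p ((s # t # w) ! i) ((t # w) ! i))"
      by (subst prod.lessThan_Suc_shift) (simp add: ennreal_mult prod_nonneg p0)
    finally show ?case by simp
  qed simp_all
  ultimately show ?thesis unfolding markov_measure_def by blast
qed

lemma shift_derivative_of_scaling: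
  assumes scal: "\<And>s B. B \<in> sets M \<Longrightarrow> \<forall>x\<in>B. A s (x 0) = 1 \<Longrightarrow>
       emeasure M (prepend A [s] B) = ennreal (exp (\<kappa> - h (f s))) * emeasure M B"
  shows "is_shift_derivative A M (\<lambda>x. ennreal (exp (- \<kappa>) * exp (h (\<phi> x))))"
  unfolding is_shift_derivative_def
proof (intro conjI ballI impI)
  have "(\<lambda>x. ennreal (exp (- \<kappa>) * exp (h (f (x 0))))) \<in> borel_measurable M"
    by (rule measurable_compose[OF measurable_letter]) simp
  then show meas: "(\<lambda>x. ennreal (exp (- \<kappa>) * exp (h (\<phi> x)))) \<in> borel_measurable M"
    by (rule measurable_cong[THEN iffD1, rotated]) (simp add: \<phi>_eq)
  fix a B assume "a \<in> state_partition A" and B: "B \<in> sets M" "B \<subseteq> a"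
  then obtain s where Bs: "B \<subseteq> cyl s" by (auto simp: state_partition_def)
  define D where "D = {z \<in> tms A. [s] \<frown> z \<in> B}"
  have shift: "left_shift x = suffix 1 x" for x :: "nat \<Rightarrow> 's"
    by (rule ext) (simp add: left_shift_def)
  have conc: "[s] \<frown> left_shift x = x" if "x \<in> B" for x
  proof -
    have "x 0 = s" using that Bs by (auto simp: mem_cylinder_state)
    then show ?thesis using conc_prefix_suffix[where n=1 and x=x] by (simp add: shift)
  qed
  have D_eq: "left_shift ` B = D"
  proof
    show "left_shift ` B \<subseteq> D"
    proof
      fix y assume "y \<in> left_shift ` B"
      then obtain x where x: "x \<in> B" "y = left_shift x" by blast
      then have "x \<in> tms A" using sets_subset_tms[OF B(1)] by blast
      then have "y \<in> tms A" unfolding x(2) shift by (rule tms_suffix)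
      then show "y \<in> D" unfolding D_def using conc[OF x(1)] x by simp
    qed
    show "D \<subseteq> left_shift ` B"
    proof
      fix z assume z: "z \<in> D"
      have "left_shift ([s] \<frown> z) = z" by (rule ext) (simp add: left_shift_def)
      then show "z \<in> left_shift ` B" using z unfolding D_def by (metis (mono_tags, lifting) image_eqI mem_Collect_eq)
    qed
  qed
  have D: "D \<in> sets M" unfolding D_def by (rule vimage_conc_in_sets[OF B(1)])
  then show "left_shift ` B \<in> sets M" by (simp add: D_eq)
  have "A s (z 0) = 1" if "z \<in> D" for z
  proof -
    have "s ## z \<in> tms A" using that sets_subset_tms[OF B(1)] by (auto simp: D_def)
    then show ?thesis by (simp add: tms_build)
  qed
  then have "emeasure M (prepend A [s] D) = ennreal (exp (\<kappa> - h (f s))) * emeasure M D"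
    using D by (intro scal) auto
  moreover have "prepend A [s] D = B"
  proof
    show "prepend A [s] D \<subseteq> B" by (auto simp: prepend_def D_def)
    show "B \<subseteq> prepend A [s] D"
    proof
      fix x assume x: "x \<in> B"
      then have "x \<in> tms A" "left_shift x \<in> D" using sets_subset_tms[OF B(1)] D_eq by blast+
      then show "x \<in> prepend A [s] D" unfolding prepend_def mem_Collect_eq
        using conc[OF x] by (intro exI[of _ "left_shift x"]) simp
    qed
  qed
  ultimately have MB: "emeasure M B = ennreal (exp (\<kappa> - h (f s))) * emeasure M D" by simp
  have "(\<integral>\<^sup>+x\<in>B. ennreal (exp (- \<kappa>) * exp (h (\<phi> x))) \<partial>M)
      = (\<integral>\<^sup>+x. ennreal (exp (h (f s) - \<kappa>)) * indicator B x \<partial>M)"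
  proof (rule nn_integral_cong)
    fix x
    show "ennreal (exp (- \<kappa>) * exp (h (\<phi> x))) * indicator B x = ennreal (exp (h (f s) - \<kappa>)) * indicator B x"
    proof (cases "x \<in> B")
      case True
      then have "\<phi> x = f s" using Bs \<phi>_eq[of x] by (auto simp: mem_cylinder_state)
      then show ?thesis by (simp add: exp_add[symmetric])
    qed simp
  qed
  also have "\<dots> = ennreal (exp (h (f s) - \<kappa>)) * emeasure M B"
    using B(1) by (rule nn_integral_cmult_indicator)
  also have "\<dots> = ennreal (exp (h (f s) - \<kappa>) * exp (\<kappa> - h (f s))) * emeasure M D"
    by (simp add: MB ennreal_mult mult.assoc)
  also have "exp (h (f s) - \<kappa>) * exp (\<kappa> - h (f s)) = 1"
    by (simp add: exp_add[symmetric])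
  finally show "emeasure M (left_shift ` B) = (\<integral>\<^sup>+x\<in>B. ennreal (exp (- \<kappa>) * exp (h (\<phi> x))) \<partial>M)"
    by (simp add: D_eq)
qed

end

section \<open>Mixing topological Markov shifts\<close>

text \<open>By Baire's theorem one of the countably many singletons is open, and by translation all are.\<close>

lemma countable_completely_metrizable_group_discrete:
  fixes S :: "'g::topological_ab_group_add set"
  assumes count: "countable (UNIV :: 'g set)"
    and cm: "completely_metrizable_space (euclidean :: 'g topology)"
  shows "closed S"
proof -
  let ?E = "euclidean :: 'g topology"
  have "Hausdorff_space ?E"
    using cm by (intro metrizable_imp_Hausdorff_space completely_metrizable_imp_metrizable_space)
  then have cl: "closedin ?E {x}" for x
    by (intro closedin_Hausdorff_singleton) simp_all
  have "\<exists>x. ?E interior_of {x} \<noteq> {}"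
  proof (rule ccontr)
    assume "\<not> ?thesis"
    then have "?E interior_of \<Union>(range (\<lambda>x. {x})) = {}"
      using cm count cl by (intro Baire_category_alt) auto
    moreover have "\<Union>(range (\<lambda>x::'g. {x})) = UNIV" by auto
    ultimately have "(UNIV :: 'g set) = {}" by (metis interior_of_topspace topspace_euclidean)
    then show False by simp
  qed
  then obtain x where x: "?E interior_of {x} \<noteq> {}" by blast
  then have "?E interior_of {x} = {x}" using interior_of_subset[of ?E "{x}"] by blast
  then have op: "open {x}" by (metis open_openin openin_interior_of)
  have opy: "open {y}" for y :: 'g
  proof -
    have "continuous_on UNIV (\<lambda>z. z + (x - y))" by (intro continuous_intros)
    then have "open ((\<lambda>z. z + (x - y)) -` {x})" using op by (rule open_vimage[rotated])
    moreover have "(\<lambda>z. z + (x - y)) -` {x} = {y}" by (auto simp: algebra_simps)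
    ultimately show ?thesis by simp
  qed
  have "open (\<Union>y\<in>- S. {y})" using opy by blast
  then show ?thesis by (simp add: closed_def)
qed

lemma group_closure_mono: "S \<subseteq> T \<Longrightarrow> group_closure S \<subseteq> group_closure T"
proof
  fix g assume ST: "S \<subseteq> T" and "g \<in> group_closure S"
  from this(2) show "g \<in> group_closure T"
    by induction (use ST in \<open>auto intro: group_closure.intros\<close>)
qed

theorem theorem5p0:
  fixes A :: "'s::countable \<Rightarrow> 's \<Rightarrow> nat"
    and \<phi> :: "(nat \<Rightarrow> 's) \<Rightarrow> 'g::topological_ab_group_add"
    and \<nu> :: "(nat \<Rightarrow> 's) measure"
  assumes "is_tms A" and "mixing A"
    and "countable (UNIV :: 'g set)"
    and "locally_compact_space (euclidean :: 'g topology)"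
    and "completely_metrizable_space (euclidean :: 'g topology)"
    and "second_countable (euclidean :: 'g topology)"
    and "partition_measurable A \<phi>" and "aperiodic A \<phi>"
    and "sets \<nu> = sets (tms_borel A)" and "sigma_finite_measure \<nu>"
    and "globally_supported A \<nu>" and "locally_finite A \<nu>"
    and "relation_invariant (tail_relation A \<phi>) \<nu>"
    and "relation_ergodic (tail_relation A \<phi>) \<nu>"
    and "recurrent A \<nu>"
  shows "\<nu> \<in> partition_finite_measures A \<and> markov_measure A \<nu> \<and>
    (\<exists>(h :: 'g \<Rightarrow> real) (c :: real). Modules.additive h \<and> c > 0 \<and>
       is_shift_derivative A \<nu> (\<lambda>x. ennreal (c * exp (h (\<phi> x)))))"
proof -
  define f where "f s = \<phi> (SOME x. x \<in> cylinder A [s])" for s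
  have nonempty: "cylinder A [s] \<noteq> {}" for s using assms(1) by (simp add: is_tms_def)
  have \<phi>_eq: "\<phi> x = f (x 0)" if "x \<in> tms A" for x
  proof -
    have "x \<in> cylinder A [x 0]" using that by (simp add: mem_cylinder_state)
    moreover from this have "(SOME y. y \<in> cylinder A [x 0]) \<in> cylinder A [x 0]" by (rule someI[where P="\<lambda>y. y \<in> cylinder A [x 0]"])
    ultimately show ?thesis
      using assms(7) unfolding partition_measurable_def state_partition_def f_def by blast
  qed
  have paths: "\<exists>N. \<forall>n\<ge>N. \<exists>w. length w = n \<and> word_path A a w b" for a b
  proof -
    have "\<forall>\<^sub>F n in sequentially. cylinder A [a] \<inter> (left_shift ^^ n) -` cylinder A [b] \<noteq> {}"
      using assms(2) unfolding mixing_def state_partition_def by blast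
    then obtain N where N: "\<And>n. n \<ge> N \<Longrightarrow> cylinder A [a] \<inter> (left_shift ^^ n) -` cylinder A [b] \<noteq> {}"
      unfolding eventually_sequentially by blast
    have "\<exists>w. length w = n \<and> word_path A a w b" if n: "n \<ge> N" for n
    proof -
      obtain x where "x \<in> cylinder A [a]" "(left_shift ^^ n) x \<in> cylinder A [b]" using N[OF n] by blast
      then have "x \<in> tms A" "x 0 = a" "x n = b" by (simp_all add: mem_cylinder_state funpow_left_shift)
      then show ?thesis using prefix_word_path[of x A n] by (intro exI[of _ "prefix n x"]) simp
    qed
    then show ?thesis by blast
  qed
  have connected: "\<exists>w. word_path A a w b" for a b using paths[of a b] by blast
  interpret T: tail_ergodic_measure A \<nu> \<phi> f
    by unfold_locales (fact assms nonempty \<phi>_eq connected)+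
  let ?S = "{birkhoff_sum \<phi> n x - birkhoff_sum \<phi> n y |n x y.
       n \<ge> 1 \<and> x \<in> tms A \<and> y \<in> tms A \<and> (left_shift ^^ n) x = x \<and> (left_shift ^^ n) y = y}"
  let ?S' = "{T.fsum p - T.fsum q |p q. length p = length q \<and> (\<exists>b. word_path A b p b) \<and> (\<exists>b. word_path A b q b)}"
  have periodic: "\<exists>b. word_path A b (prefix n x) b" if "x \<in> tms A" "(left_shift ^^ n) x = x" for n x
  proof -
    have "x n = x 0" using fun_cong[OF that(2), of 0] by (simp add: funpow_left_shift)
    then show ?thesis using prefix_word_path[OF that(1), of n] by auto
  qed
  have "?S \<subseteq> ?S'"
  proof
    fix g assume "g \<in> ?S"
    then obtain n x y where g: "g = birkhoff_sum \<phi> n x - birkhoff_sum \<phi> n y" and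
      x: "x \<in> tms A" "(left_shift ^^ n) x = x" and y: "y \<in> tms A" "(left_shift ^^ n) y = y" by blast
    have "g = T.fsum (prefix n x) - T.fsum (prefix n y)"
      using x y by (simp add: g T.birkhoff_sum_eq)
    moreover have "length (prefix n x) = length (prefix n y)" by simp
    ultimately show "g \<in> ?S'" using periodic[OF x] periodic[OF y] by blast
  qed
  moreover have "group_closure ?S = UNIV"
    using assms(8) closure_closed[OF countable_completely_metrizable_group_discrete[OF assms(3,5)]]
    unfolding aperiodic_def by metis
  ultimately have gen: "group_closure ?S' = UNIV"
    using group_closure_mono[of ?S ?S'] by (simp add: top.extremum_unique)
  interpret P: aperiodic_tail_ergodic_measure A \<nu> \<phi> f
  proof unfold_locales
    fix a
    obtain N where N: "\<forall>n\<ge>N. \<exists>w. length w = n \<and> word_path A a w a" using paths[of a a] by blast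
    obtain u where "length u = Suc N" "word_path A a u a" using N le_SucI by blast
    moreover obtain v where "length v = N" "word_path A a v a" using N by blast
    ultimately show "\<exists>u v. word_path A a u a \<and> word_path A a v a \<and> length u = Suc (length v)" by blast
  qed (rule gen)
  have "\<nu> \<in> partition_finite_measures A"
    using assms(10) T.cyl_finite by (auto simp: partition_finite_measures_def state_partition_def assms(9))
  moreover obtain h :: "'g \<Rightarrow> real" and \<kappa> where h: "Modules.additive h"
    and scal: "\<And>s B. B \<in> sets \<nu> \<Longrightarrow> \<forall>x\<in>B. A s (x 0) = 1 \<Longrightarrow>
       emeasure \<nu> (prepend A [s] B) = ennreal (exp (\<kappa> - h (f s))) * emeasure \<nu> B"
    using P.letter_scaling by blast
  moreover have "is_shift_derivative A \<nu> (\<lambda>x. ennreal (exp (- \<kappa>) * exp (h (\<phi> x))))"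
    by (rule P.shift_derivative_of_scaling) (rule scal)
  moreover have "exp (- \<kappa>) > 0" by simp
  ultimately show ?thesis using P.markov by blast
qed

end
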